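(* Let $d\ge1$ and let $L_m$ be the Dirichlet $L$-function associated to a principal Dirichlet character $\chi_m$. Let $$\sigma_0(L_m):=\sup\{\sigma\in\mathbb{R}:\ \text{there exists } t\in\mathbb{R}\text{ such that }\operatorname{Re}L_m(\sigma+it)=0\}.$$ Let $g=g_1+ig_2\in L^\infty(\mathbb{R}^d;\mathbb{C})\cap C(\mathbb{R}^d;\mathbb{C})$, with $g_1,g_2$ real-valued, and set $I_j=\inf_{x\in\mathbb{R}^d}g_j(x)$, $S_j=\sup_{x\in\mathbb{R}^d}g_j(x)$ for $j=1,2$. Assume $$I_1>\max\{1,\sigma_0(L_m)\}.$$ Let $u$ be the local solution of $$\partial_t u(t,x)=\Delta u(t,x)+L_m(u(t,x)),\quad x\in\mathbb{R}^d,\ t\ge0,\qquad u(0,x)=g(x).$$ Then $u$ is globally well-defined. Moreover, writing $u=u_1+iu_2$ with $u_1,u_2$ real-valued, one has for all $t\ge0$ and $x\in\mathbb{R}^d$ $$\max\{0,2-\zeta(I_1)\}\,t+I_1\le u_1(t,x)\le \zeta(I_1)\,t+S_1$$ and $$(1-\zeta(I_1))\,t+I_2\le u_2(t,x)\le(\zeta(I_1)-1)\,t+S_2 .$$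
   Context: $\zeta$ is the Riemann zeta function. A Dirichlet character of period $m\in\mathbb{N}=\{1,2,3,\dots\}$ is a function $\chi_m:\mathbb{N}\to\mathbb{C}$ that is $m$-periodic, completely multiplicative, with $\chi_m(n)\ne0$ if $\gcd(n,m)=1$ and $\chi_m(n)=0$ if $\gcd(n,m)>1$; it is principal if $\chi_m(n)=1$ whenever $\gcd(n,m)=1$. Its Dirichlet $L$-function is $L_m(s)=\sum_{n\ge1}\chi_m(n)n^{-s}$ for $\operatorname{Re}(s)>1$, extended meromorphically to $\mathbb{C}$, with (in the principal case) a unique pole at $s=1$. The local solution is the unique solution in $C([0,T);L^\infty(\mathbb{R}^d;\mathbb{C})\cap C(\mathbb{R}^d;\mathbb{C}))$, up to its maximal time of existence, in the Duhamel sense $u(t)=e^{t\Delta}g+\int_0^te^{(t-s)\Delta}L_m(u(s))\,ds$, where $e^{t\Delta}$ is convolution with the heat kernel $(4\pi t)^{-d/2}e^{-|x|^2/(4t)}$. Globally well-defined means that the maximal time of existence is $+\infty$.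
   Formalization: For g not uniformly continuous no Duhamel solution is sup-norm continuous at t=0, so the solution class is taken as continuous on (0,T) with u(t)-e^{tΔ}g → 0 uniformly as t→0+; for uniformly continuous g this is the same as C([0,T); L^∞∩C). *)

theory Defs
  imports "HOL-Complex_Analysis.Complex_Analysis"
begin

section \<open>Dirichlet characters and their L-functions\<close>

text \<open>Characters are functions on the positive integers; the value at 0 is irrelevant.\<close>

definition dirichlet_character :: "nat \<Rightarrow> (nat \<Rightarrow> complex) \<Rightarrow> bool" where
  "dirichlet_character m chi \<longleftrightarrow> m \<ge> 1 \<and>
     (\<forall>n\<ge>1. chi (n + m) = chi n) \<and>
     (\<forall>a\<ge>1. \<forall>b\<ge>1. chi (a * b) = chi a * chi b) \<and>
     (\<forall>n\<ge>1. gcd n m = 1 \<longrightarrow> chi n \<noteq> 0) \<and>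
     (\<forall>n\<ge>1. gcd n m > 1 \<longrightarrow> chi n = 0)"

definition principal_character :: "nat \<Rightarrow> (nat \<Rightarrow> complex) \<Rightarrow> bool" where
  "principal_character m chi \<longleftrightarrow> dirichlet_character m chi \<and> (\<forall>n\<ge>1. gcd n m = 1 \<longrightarrow> chi n = 1)"

definition dirichlet_series :: "(nat \<Rightarrow> complex) \<Rightarrow> complex \<Rightarrow> complex" where
  "dirichlet_series chi s = (\<Sum>n. chi (Suc n) * of_nat (Suc n) powr (-s))"

text \<open>The meromorphic extension is unique once its removable singularities are removed and its
  poles are given the value 0, which is what \<^const>\<open>nicely_meromorphic_on\<close> requires. Notions
  below that depend on values of an L-function exclude poles explicitly.\<close>

definition dirichlet_L :: "(nat \<Rightarrow> complex) \<Rightarrow> complex \<Rightarrow> complex" where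
  "dirichlet_L chi s =
     (if Re s > 1 then dirichlet_series chi s
      else (THE f. f nicely_meromorphic_on UNIV \<and> (\<forall>z. Re z > 1 \<longrightarrow> f z = dirichlet_series chi z)) s)"

definition riemann_zeta :: "complex \<Rightarrow> complex" where
  "riemann_zeta = dirichlet_L (\<lambda>_. 1)"

text \<open>The supremum is taken in the extended reals, so that it carries no hidden assumption that
  the set is nonempty or bounded above.\<close>

definition sigma0 :: "(complex \<Rightarrow> complex) \<Rightarrow> ereal" where
  "sigma0 L = Sup (ereal ` {\<sigma>. \<exists>t. \<not> is_pole L (Complex \<sigma> t) \<and> Re (L (Complex \<sigma> t)) = 0})"

section \<open>Mild solutions of the nonlinear heat equation\<close>

definition heat_kernel :: "real \<Rightarrow> 'a::euclidean_space \<Rightarrow> real" where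
  "heat_kernel t x = (4 * pi * t) powr (- (real DIM('a) / 2)) * exp (- (norm x)\<^sup>2 / (4 * t))"

definition heat_semigroup :: "real \<Rightarrow> ('a::euclidean_space \<Rightarrow> complex) \<Rightarrow> 'a \<Rightarrow> complex" where
  "heat_semigroup t f x =
     (if t = 0 then f x else (LINT y|lborel. heat_kernel t (x - y) *\<^sub>R f y))"

text \<open>The type \<open>'a \<Rightarrow>\<^sub>C complex\<close> is the space of bounded continuous functions with the sup norm.
  For bounded continuous \<open>g\<close> that is not uniformly continuous, the heat evolution of \<open>g\<close> is
  norm continuous for \<open>t > 0\<close> but not at \<open>t = 0\<close>, so no Duhamel solution can be norm continuous at 0.
  As usual for bounded continuous data, continuity at 0 is therefore understood as uniform
  convergence to 0 of the difference between \<open>u(t)\<close> and the heat evolution of \<open>g\<close>. When \<open>g\<close> is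
  uniformly continuous, this is the same as norm continuity on the whole of \<open>[0,T)\<close>.
  The solution must avoid the poles of the nonlinearity \<open>F\<close>, and \<open>F(u(t))\<close> has to lie in the
  same space, so that the heat semigroup may be applied to it.\<close>

definition mild_solution ::
  "(complex \<Rightarrow> complex) \<Rightarrow> ('a::euclidean_space \<Rightarrow>\<^sub>C complex) \<Rightarrow> ereal \<Rightarrow>
   (real \<Rightarrow> ('a \<Rightarrow>\<^sub>C complex)) \<Rightarrow> bool" where
  "mild_solution F g T u \<longleftrightarrow> T > 0 \<and>
     continuous_on {t. 0 < t \<and> ereal t < T} u \<and>
     uniform_limit UNIV
       (\<lambda>t x. apply_bcontfun (u t) x - heat_semigroup t (apply_bcontfun g) x) (\<lambda>_. 0) (at_right 0) \<and>
     (\<forall>t. 0 \<le> t \<and> ereal t < T \<longrightarrow>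
        (\<forall>x. \<not> is_pole F (apply_bcontfun (u t) x)) \<and>
        (\<lambda>x. F (apply_bcontfun (u t) x)) \<in> bcontfun \<and>
        (\<forall>x. set_integrable lborel {0..t}
               (\<lambda>s. heat_semigroup (t - s) (\<lambda>y. F (apply_bcontfun (u s) y)) x) \<and>
             apply_bcontfun (u t) x =
               heat_semigroup t (apply_bcontfun g) x +
               (LINT s:{0..t}|lborel.
                  heat_semigroup (t - s) (\<lambda>y. F (apply_bcontfun (u s) y)) x)))"

text \<open>The local solution, taken up to its maximal time of existence \<open>T\<close>: every mild solution
  is a restriction of it.\<close>

definition local_solution ::
  "(complex \<Rightarrow> complex) \<Rightarrow> ('a::euclidean_space \<Rightarrow>\<^sub>C complex) \<Rightarrow> ereal \<Rightarrow>
   (real \<Rightarrow> ('a \<Rightarrow>\<^sub>C complex)) \<Rightarrow> bool" where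
  "local_solution F g T u \<longleftrightarrow> mild_solution F g T u \<and>
     (\<forall>T' v. mild_solution F g T' v \<longrightarrow>
        T' \<le> T \<and> (\<forall>t. 0 \<le> t \<and> ereal t < T' \<longrightarrow> v t = u t))"

end

theory Submission
  imports Defs "HOL-Probability.Distributions"
begin

text \<open>
  The half-plane \<open>H = {Re z \<ge> I1}\<close> is invariant under the equation, and on \<open>H\<close> everything is
  explicit. Since \<open>I1 > 1\<close>, the function \<open>L\<close> is given there by its absolutely convergent Dirichlet
  series, so that \<open>\<bar>L\<bar> \<le> \<zeta>(I1)\<close>, \<open>\<bar>L - 1\<bar> \<le> \<zeta>(I1) - 1\<close> and \<open>L\<close> is Lipschitz
  (\<open>norm_dirichlet_series_le\<close>, \<open>norm_dirichlet_series_diff_le\<close>, \<open>dirichlet_series_lipschitz\<close>).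
  Moreover \<open>Re L > 0\<close> on \<open>Re z > max 1 \<sigma>\<^sub>0\<close>: the
  coefficients of a principal character are \<open>0\<close> or \<open>1\<close>, so \<open>L\<close> is at least its first term \<open>1\<close> on
  the real axis, and \<open>Re L\<close> has no zero on the vertical lines to the right of \<open>\<sigma>\<^sub>0\<close>
  (\<open>Re_dirichlet_series_pos\<close>).

  Existence. Let \<open>G\<close> be \<open>L\<close> composed with the nearest-point projection onto \<open>H\<close>. It is bounded
  and Lipschitz on the whole plane, so Picard iteration of the Duhamel map converges for all times
  (\<open>exists_mild_flow\<close>). Because the heat kernel is a probability density, bounds on the real and
  imaginary parts of a function pass through the heat semigroup; integrating the bounds for \<open>G\<close> over
  \<open>[0,t]\<close> in the Duhamel formula gives the four inequalities of the theorem. The first of them shows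
  that the solution stays in \<open>H\<close>, where \<open>G\<close> is \<open>L\<close>, so it solves the original equation.

  Uniqueness. An arbitrary mild solution could leave \<open>H\<close> and meet the continuation of \<open>L\<close>. It does
  not: by continuity it stays for a short time in the slightly larger half-plane where still
  \<open>Re L \<ge> 0\<close>, and then the Duhamel formula puts it back into \<open>H\<close>
  (\<open>Re_mild_solution_ge\<close>). Hence it also solves the equation with nonlinearity \<open>G\<close>, for which
  solutions are unique (\<open>mild_flow_unique\<close>). The global solution is therefore the maximal one.

  As the heat semigroup is not strongly continuous at time \<open>0\<close> on bounded continuous functions, the
  Duhamel integral is taken pointwise in \<open>x\<close>. Its continuity in time rests on the
  estimate \<open>heat_semigroup_time_diff\<close> of the semigroup away from time \<open>0\<close>.
\<close>

section \<open>The heat semigroup on bounded continuous functions\<close>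

lemma heat_kernel_nonneg: "0 \<le> heat_kernel t x"
  by (simp add: heat_kernel_def)

text \<open>The Gaussian factorises over the coordinates, into normal densities of variance \<open>2t\<close>.\<close>

lemma heat_kernel_eq_prod_normal_density:
  fixes x y :: "'a::euclidean_space"
  assumes "t > 0"
  shows "heat_kernel t (x - y) = (\<Prod>b\<in>Basis. normal_density (x \<bullet> b) (sqrt (2 * t)) (y \<bullet> b))"
proof -
  have "(\<Prod>b\<in>(Basis::'a set). normal_density (x \<bullet> b) (sqrt (2 * t)) (y \<bullet> b))
      = (\<Prod>b\<in>(Basis::'a set). (4 * pi * t) powr (-1/2) * exp (- ((x - y) \<bullet> b)\<^sup>2 / (4 * t)))"
  proof (rule prod.cong[OF refl])
    fix b :: 'a
    have "1 / sqrt (2 * pi * (2 * t)) = (4 * pi * t) powr (-1/2)"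
      using assms by (simp add: powr_minus powr_half_sqrt field_simps)
    moreover have "(y \<bullet> b - x \<bullet> b)\<^sup>2 = ((x - y) \<bullet> b)\<^sup>2"
      by (simp add: inner_diff_left power2_commute)
    ultimately show "normal_density (x \<bullet> b) (sqrt (2 * t)) (y \<bullet> b)
        = (4 * pi * t) powr (-1/2) * exp (- ((x - y) \<bullet> b)\<^sup>2 / (4 * t))"
      using assms by (simp add: normal_density_def)
  qed
  also have "\<dots> = ((4 * pi * t) powr (-1/2)) ^ DIM('a) * exp (\<Sum>b\<in>(Basis::'a set). - ((x - y) \<bullet> b)\<^sup>2 / (4 * t))"
    by (simp add: prod.distrib exp_sum)
  also have "((4 * pi * t) powr (-1/2)) ^ DIM('a) = (4 * pi * t) powr (- (real DIM('a) / 2))"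
    using assms by (simp add: powr_powr flip: powr_realpow)
  also have "(\<Sum>b\<in>(Basis::'a set). - ((x - y) \<bullet> b)\<^sup>2 / (4 * t)) = - (norm (x - y))\<^sup>2 / (4 * t)"
    unfolding power2_norm_eq_inner euclidean_inner[of "x - y" "x - y"]
    by (simp add: sum_negf power2_eq_square flip: sum_divide_distrib)
  finally show ?thesis by (simp add: heat_kernel_def)
qed

lemma heat_kernel_integral_one:
  fixes x :: "'a::euclidean_space"
  assumes "t > 0"
  shows "has_bochner_integral lborel (\<lambda>y. heat_kernel t (x - y)) 1"
proof (rule has_bochner_integral_nn_integral)
  show "(\<lambda>y. heat_kernel t (x - y)) \<in> borel_measurable lborel"
    unfolding heat_kernel_def by measurable
  show "(\<integral>\<^sup>+ y. ennreal (heat_kernel t (x - y)) \<partial>lborel) = ennreal 1"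
  proof -
    have "(\<integral>\<^sup>+ y. ennreal (heat_kernel t (x - y)) \<partial>lborel)
       = (\<integral>\<^sup>+ y. (\<Prod>b\<in>Basis. ennreal (normal_density (x \<bullet> b) (sqrt (2 * t)) (y \<bullet> b))) \<partial>lborel)"
      using assms by (simp add: heat_kernel_eq_prod_normal_density prod_ennreal)
    also have "\<dots> = (\<Prod>b\<in>Basis. (\<integral>\<^sup>+ s. ennreal (normal_density (x \<bullet> b) (sqrt (2 * t)) s) \<partial>lborel))"
      by (rule nn_integral_lborel_prod) auto
    also have "\<dots> = (\<Prod>b\<in>(Basis::'a set). 1)"
    proof (rule prod.cong[OF refl])
      fix b :: 'a
      have "sqrt (2 * t) > 0" using assms by simp
      then show "(\<integral>\<^sup>+ s. ennreal (normal_density (x \<bullet> b) (sqrt (2 * t)) s) \<partial>lborel) = 1"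
        by (subst nn_integral_eq_integral) auto
    qed
    finally show ?thesis by simp
  qed
qed (auto simp: heat_kernel_nonneg)

lemma integrable_heat_kernel:
  "t > 0 \<Longrightarrow> integrable lborel (\<lambda>y. heat_kernel t (x - y :: 'a::euclidean_space))"
  and integral_heat_kernel: "t > 0 \<Longrightarrow> (LINT y|lborel. heat_kernel t (x - y)) = 1"
  using heat_kernel_integral_one[of t x]
  by (auto simp: has_bochner_integral_iff)

lemma integrable_heat_kernel_scaleR:
  fixes f :: "'a::euclidean_space \<Rightarrow> complex"
  assumes "t > 0" "f \<in> bcontfun"
  shows "integrable lborel (\<lambda>y. heat_kernel t (x - y) *\<^sub>R f y)"
proof -
  obtain B where B: "\<And>y. norm (f y) \<le> B"
    using assms(2) by (auto simp: bcontfun_def bounded_iff)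
  have [measurable]: "f \<in> borel_measurable borel"
    using assms(2) by (auto simp: bcontfun_def intro: borel_measurable_continuous_onI)
  show ?thesis
  proof (rule Bochner_Integration.integrable_bound)
    show "integrable lborel (\<lambda>y. B * heat_kernel t (x - y))"
      using integrable_heat_kernel[OF assms(1), of x] by simp
    show "(\<lambda>y. heat_kernel t (x - y) *\<^sub>R f y) \<in> borel_measurable lborel"
      unfolding heat_kernel_def by measurable
    have "heat_kernel t (x - y) * norm (f y) \<le> \<bar>B\<bar> * heat_kernel t (x - y)" for y
      using mult_right_mono[OF order_trans[OF B abs_ge_self[of B]] heat_kernel_nonneg[of t "x - y"]]
      by (simp add: mult.commute)
    then show "AE y in lborel. norm (heat_kernel t (x - y) *\<^sub>R f y) \<le> norm (B * heat_kernel t (x - y))"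
      by (auto simp: abs_mult heat_kernel_nonneg)
  qed
qed

lemma heat_semigroup_diff:
  fixes f g :: "'a::euclidean_space \<Rightarrow> complex"
  assumes "t \<ge> 0" "f \<in> bcontfun" "g \<in> bcontfun"
  shows "heat_semigroup t (\<lambda>y. f y - g y) x = heat_semigroup t f x - heat_semigroup t g x"
  using assms integrable_heat_kernel_scaleR[of t f x] integrable_heat_kernel_scaleR[of t g x]
  by (auto simp: heat_semigroup_def scaleR_diff_right)

text \<open>The value at \<open>x\<close> is an average of \<open>f\<close> against a probability density. This one-sided form of the
  maximum principle carries the bounds on solutions.\<close>

lemma Re_heat_semigroup_bounds:
  fixes f :: "'a::euclidean_space \<Rightarrow> complex"
  assumes t: "t \<ge> 0" and f: "f \<in> bcontfun"
  shows "(\<And>y. a \<le> Re (f y)) \<Longrightarrow> a \<le> Re (heat_semigroup t f x)"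
    and "(\<And>y. Re (f y) \<le> a) \<Longrightarrow> Re (heat_semigroup t f x) \<le> a"
    and "(\<And>y. a \<le> Im (f y)) \<Longrightarrow> a \<le> Im (heat_semigroup t f x)"
    and "(\<And>y. Im (f y) \<le> a) \<Longrightarrow> Im (heat_semigroup t f x) \<le> a"
proof -
  let ?k = "\<lambda>y. heat_kernel t (x - y)"
  have key: "Re (heat_semigroup t f x) = (LINT y|lborel. ?k y * Re (f y))"
       "integrable lborel (\<lambda>y. ?k y * Re (f y))"
       "Im (heat_semigroup t f x) = (LINT y|lborel. ?k y * Im (f y))"
       "integrable lborel (\<lambda>y. ?k y * Im (f y))"
       "integrable lborel (\<lambda>y. ?k y * a)" "(LINT y|lborel. ?k y * a) = a" if "t > 0"
    using integrable_heat_kernel_scaleR[OF that f, of x] that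
      integrable_Re[OF integrable_heat_kernel_scaleR[OF that f, of x]]
      integrable_Im[OF integrable_heat_kernel_scaleR[OF that f, of x]]
      integrable_heat_kernel[OF that, of x] integral_heat_kernel[OF that, of x]
    by (simp_all add: heat_semigroup_def flip: integral_Re integral_Im)
  have mono: "(LINT y|lborel. ?k y * p y) \<le> (LINT y|lborel. ?k y * q y)"
    if "integrable lborel (\<lambda>y. ?k y * p y)" "integrable lborel (\<lambda>y. ?k y * q y)" "\<And>y. p y \<le> q y" for p q
    using that by (intro integral_mono mult_left_mono heat_kernel_nonneg) auto
  show "a \<le> Re (heat_semigroup t f x)" if "\<And>y. a \<le> Re (f y)"
    using that t key mono[of "\<lambda>_. a" "\<lambda>y. Re (f y)"]
    by (cases "t = 0") (auto simp: heat_semigroup_def)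
  show "Re (heat_semigroup t f x) \<le> a" if "\<And>y. Re (f y) \<le> a"
    using that t key mono[of "\<lambda>y. Re (f y)" "\<lambda>_. a"]
    by (cases "t = 0") (auto simp: heat_semigroup_def)
  show "a \<le> Im (heat_semigroup t f x)" if "\<And>y. a \<le> Im (f y)"
    using that t key mono[of "\<lambda>_. a" "\<lambda>y. Im (f y)"]
    by (cases "t = 0") (auto simp: heat_semigroup_def)
  show "Im (heat_semigroup t f x) \<le> a" if "\<And>y. Im (f y) \<le> a"
    using that t key mono[of "\<lambda>y. Im (f y)" "\<lambda>_. a"]
    by (cases "t = 0") (auto simp: heat_semigroup_def)
qed

lemma norm_heat_semigroup_le:
  fixes f :: "'a::euclidean_space \<Rightarrow> complex"
  assumes t: "t \<ge> 0" and f: "f \<in> bcontfun" and B: "\<And>y. norm (f y) \<le> B"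
  shows "norm (heat_semigroup t f x) \<le> B"
proof (cases "t = 0")
  case True then show ?thesis using B by (simp add: heat_semigroup_def)
next
  case False
  with t have t: "t > 0" by simp
  have "norm (LINT y|lborel. heat_kernel t (x - y) *\<^sub>R f y) \<le> (LINT y|lborel. B * heat_kernel t (x - y))"
  proof (rule Bochner_Integration.integral_norm_bound_integral)
    show "integrable lborel (\<lambda>y. heat_kernel t (x - y) *\<^sub>R f y)"
      by (rule integrable_heat_kernel_scaleR[OF t f])
    show "integrable lborel (\<lambda>y. B * heat_kernel t (x - y))"
      using integrable_heat_kernel[OF t, of x] by simp
    show "norm (heat_kernel t (x - y) *\<^sub>R f y) \<le> B * heat_kernel t (x - y)" for y
      using mult_right_mono[OF B heat_kernel_nonneg, of y t "x - y"]
      by (simp add: heat_kernel_nonneg mult.commute)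
  qed
  then show ?thesis using t integral_heat_kernel[OF t, of x] by (simp add: heat_semigroup_def)
qed

lemma lborel_integral_reflect_translate:
  fixes f :: "'a::euclidean_space \<Rightarrow> 'b::{banach, second_countable_topology}"
  assumes [measurable]: "f \<in> borel_measurable borel"
  shows "(LINT y|lborel. f (x - y)) = (LINT y|lborel. f y)"
proof -
  have "lborel = distr lborel borel (\<lambda>y. x - y)"
    using lborel_affine[of "-1" x] by (simp add: density_1)
  then have "(LINT y|lborel. f y) = (LINT y|distr lborel borel (\<lambda>y. x - y). f y)"
    by simp
  also have "\<dots> = (LINT y|lborel. f (x - y))"
    by (rule integral_distr) auto
  finally show ?thesis by simp
qed

text \<open>Moving the dependence on \<open>x\<close> from the kernel to the continuous function \<open>f\<close> makes a fixed multiple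
  of the kernel a dominating function.\<close>

lemma continuous_on_heat_semigroup:
  fixes f :: "'a::euclidean_space \<Rightarrow> complex"
  assumes t: "t \<ge> 0" and f: "f \<in> bcontfun"
  shows "continuous_on UNIV (heat_semigroup t f)"
proof (cases "t = 0")
  case True then show ?thesis using f by (simp add: heat_semigroup_def bcontfun_def)
next
  case False
  with t have t: "t > 0" by simp
  obtain B where B: "\<And>y. norm (f y) \<le> B"
    using f by (auto simp: bcontfun_def bounded_iff)
  have cont: "continuous_on UNIV f" using f by (simp add: bcontfun_def)
  then have [measurable]: "f \<in> borel_measurable borel"
    by (intro borel_measurable_continuous_onI)
  have [measurable]: "(heat_kernel t :: 'a \<Rightarrow> real) \<in> borel_measurable borel"
    unfolding heat_kernel_def by measurable
  have eq: "heat_semigroup t f = (\<lambda>x. LINT z|lborel. heat_kernel t z *\<^sub>R f (x - z))"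
  proof
    fix x
    show "heat_semigroup t f x = (LINT z|lborel. heat_kernel t z *\<^sub>R f (x - z))"
      using t lborel_integral_reflect_translate[of "\<lambda>z. heat_kernel t z *\<^sub>R f (x - z)" x]
      by (simp add: heat_semigroup_def)
  qed
  show ?thesis unfolding continuous_on_sequentially eq
  proof (intro allI ballI impI, elim conjE)
    fix X :: "nat \<Rightarrow> 'a" and a assume lim: "X \<longlonglongrightarrow> a"
    show "((\<lambda>x. LINT z|lborel. heat_kernel t z *\<^sub>R f (x - z)) \<circ> X)
        \<longlonglongrightarrow> (LINT z|lborel. heat_kernel t z *\<^sub>R f (a - z))"
      unfolding o_def
    proof (rule integral_dominated_convergence[where w = "\<lambda>z. B * heat_kernel t z"])
      show "integrable lborel (\<lambda>z::'a. B * heat_kernel t z)"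
        using integrable_heat_kernel[OF t, of "0::'a"] by (simp add: heat_kernel_def)
      show "AE z in lborel. (\<lambda>i. heat_kernel t z *\<^sub>R f (X i - z)) \<longlonglongrightarrow> heat_kernel t z *\<^sub>R f (a - z)"
      proof (rule AE_I2)
        fix z
        have "isCont f (a - z)" using cont by (simp add: continuous_on_eq_continuous_at)
        then have "(\<lambda>i. f (X i - z)) \<longlonglongrightarrow> f (a - z)"
          by (rule isCont_tendsto_compose) (intro tendsto_intros lim)
        then show "(\<lambda>i. heat_kernel t z *\<^sub>R f (X i - z)) \<longlonglongrightarrow> heat_kernel t z *\<^sub>R f (a - z)"
          by (intro tendsto_intros)
      qed
      show "AE z in lborel. norm (heat_kernel t z *\<^sub>R f (X i - z)) \<le> B * heat_kernel t z" for i
        using mult_right_mono[OF B heat_kernel_nonneg, of "X i - _" t]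
        by (auto simp: heat_kernel_nonneg mult.commute)
    qed measurable
  qed
qed

lemma heat_semigroup_bcontfun:
  fixes f :: "'a::euclidean_space \<Rightarrow> complex"
  assumes "t \<ge> 0" "f \<in> bcontfun"
  shows "heat_semigroup t f \<in> bcontfun"
proof -
  obtain B where "\<And>y. norm (f y) \<le> B"
    using assms(2) by (auto simp: bcontfun_def bounded_iff)
  then show ?thesis
    by (intro bcontfun_normI[of _ B] continuous_on_heat_semigroup norm_heat_semigroup_le assms)
qed

text \<open>The exponential factor increases with time, only the normalisation decreases. So a later kernel
  dominates an earlier one up to the ratio of the normalisations.\<close>

lemma heat_kernel_scaling_le:
  fixes x :: "'a::euclidean_space"
  assumes "0 < r" "r \<le> t"
  shows "(r / t) powr (real DIM('a) / 2) * heat_kernel r x \<le> heat_kernel t x"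
proof -
  have "(r / t) powr (real DIM('a) / 2) * (4 * pi * r) powr (- (real DIM('a) / 2))
      = (4 * pi * t) powr (- (real DIM('a) / 2))"
    using assms by (simp add: powr_mult powr_divide powr_minus field_simps)
  moreover have "exp (- (norm x)\<^sup>2 / (4 * r)) \<le> exp (- (norm x)\<^sup>2 / (4 * t))"
    using assms by (auto intro!: divide_left_mono)
  ultimately show ?thesis
    unfolding heat_kernel_def mult.assoc[symmetric] by (auto intro!: mult_left_mono)
qed

text \<open>With \<open>q\<close> the ratio of the normalisations and \<open>k\<close> the kernel, \<open>k\<^sub>t - k\<^sub>r\<close> splits into the
  nonnegative part \<open>k\<^sub>t - q k\<^sub>r\<close> minus \<open>(1 - q) k\<^sub>r\<close>. Both have integral \<open>1 - q\<close>, so the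
  \<open>L\<^sup>1\<close> distance of the kernels is at most \<open>2 (1 - q)\<close>, which Bernoulli's inequality estimates.\<close>

lemma heat_semigroup_time_diff:
  fixes f :: "'a::euclidean_space \<Rightarrow> complex"
  assumes r: "0 < r" "r \<le> t" and f: "f \<in> bcontfun" and B: "\<And>y. norm (f y) \<le> B"
  shows "norm (heat_semigroup t f x - heat_semigroup r f x) \<le> 2 * B * real DIM('a) * ((t - r) / t)"
proof -
  define q where "q = (r / t) powr (real DIM('a) / 2)"
  let ?k = "\<lambda>t y. heat_kernel t (x - y)"
  have t: "t > 0" using r by simp
  have B0: "B \<ge> 0" using B norm_ge_zero order_trans by blast
  have q1: "q \<le> 1" unfolding q_def using r by (intro powr_le1) auto
  have "1 - real DIM('a) * ((t - r) / t) \<le> (1 - (t - r) / t) ^ DIM('a)"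
    using Bernoulli_inequality[of "- ((t - r) / t)" "DIM('a)"] r by (simp add: field_simps)
  also have "\<dots> = (r / t) powr real DIM('a)"
    using r by (simp add: powr_realpow field_simps)
  also have "\<dots> \<le> q"
    unfolding q_def using r by (intro powr_mono') auto
  finally have q: "1 - q \<le> real DIM('a) * ((t - r) / t)" by simp
  have "heat_semigroup t f x - heat_semigroup r f x
      = (LINT y|lborel. ?k t y *\<^sub>R f y - ?k r y *\<^sub>R f y)"
    using r t integrable_heat_kernel_scaleR[OF r(1) f, of x] integrable_heat_kernel_scaleR[OF t f, of x]
    by (simp add: heat_semigroup_def)
  also have "norm \<dots> \<le> (LINT y|lborel. B * (?k t y - q * ?k r y + (1 - q) * ?k r y))"
  proof (rule Bochner_Integration.integral_norm_bound_integral)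
    show "integrable lborel (\<lambda>y. ?k t y *\<^sub>R f y - ?k r y *\<^sub>R f y)"
      using integrable_heat_kernel_scaleR[OF r(1) f, of x] integrable_heat_kernel_scaleR[OF t f, of x] by simp
    show "integrable lborel (\<lambda>y. B * (?k t y - q * ?k r y + (1 - q) * ?k r y))"
      using integrable_heat_kernel[OF r(1), of x] integrable_heat_kernel[OF t, of x] by simp
    fix y
    have "q * ?k r y \<le> ?k t y" unfolding q_def by (rule heat_kernel_scaling_le[OF r])
    moreover have "0 \<le> (1 - q) * ?k r y" using q1 by (intro mult_nonneg_nonneg heat_kernel_nonneg) simp
    ultimately have "\<bar>?k t y - ?k r y\<bar> \<le> ?k t y - q * ?k r y + (1 - q) * ?k r y"
      by (simp add: algebra_simps)
    then have "\<bar>?k t y - ?k r y\<bar> * norm (f y) \<le> (?k t y - q * ?k r y + (1 - q) * ?k r y) * B"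
      by (intro mult_mono B) auto
    then show "norm (?k t y *\<^sub>R f y - ?k r y *\<^sub>R f y) \<le> B * (?k t y - q * ?k r y + (1 - q) * ?k r y)"
      by (simp add: mult.commute flip: scaleR_diff_left)
  qed
  also have "\<dots> = B * (2 * (1 - q))"
    using integrable_heat_kernel[OF r(1), of x] integrable_heat_kernel[OF t, of x]
      integral_heat_kernel[OF r(1), of x] integral_heat_kernel[OF t, of x] by simp
  also have "\<dots> \<le> B * (2 * (real DIM('a) * ((t - r) / t)))"
    using q B0 by (intro mult_left_mono) auto
  also have "\<dots> = 2 * B * real DIM('a) * ((t - r) / t)"
    by (simp only: mult_ac)
  finally show ?thesis .
qed

lemma norm_set_integral_le_antiderivative:
  fixes f :: "real \<Rightarrow> complex"
  assumes "a \<le> b" and f: "set_integrable lborel {a..b} f"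
    and le: "\<And>s. s \<in> {a..b} \<Longrightarrow> norm (f s) \<le> p s"
    and P: "\<And>s. s \<in> {a..b} \<Longrightarrow> (P has_real_derivative p s) (at s within {a..b})"
  shows "norm (LINT s:{a..b}|lborel. f s) \<le> P b - P a"
proof -
  have p: "(p has_integral (P b - P a)) {a..b}"
    using assms(1) P by (intro fundamental_theorem_of_calculus)
      (auto simp flip: has_real_derivative_iff_has_vector_derivative)
  have "norm (integral {a..b} f) \<le> integral {a..b} p"
    using set_borel_integral_eq_integral(1)[OF f] p le
    by (intro Henstock_Kurzweil_Integration.integral_norm_bound_integral) (auto intro: has_integral_integrable)
  then show ?thesis
    using set_borel_integral_eq_integral(2)[OF f] p by (simp add: integral_unique)
qed

text \<open>Iterating this estimate produces the factorials that make Picard iteration converge on every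
  bounded time interval.\<close>

lemma norm_set_integral_le_power:
  fixes f :: "real \<Rightarrow> complex"
  assumes "0 \<le> t" and "set_integrable lborel {0..t} f"
    and "\<And>s. s \<in> {0..t} \<Longrightarrow> norm (f s) \<le> c * s ^ n / fact n"
  shows "norm (LINT s:{0..t}|lborel. f s) \<le> c * t ^ Suc n / fact (Suc n)"
proof -
  have "((\<lambda>s. c * s ^ Suc n / fact (Suc n)) has_real_derivative c * s ^ n / fact n) (at s within {0..t})" for s
    using DERIV_cmult[OF DERIV_pow[of "Suc n" s "{0..t}"], of "c / fact (Suc n)"]
    by (simp add: divide_simps del: of_nat_Suc)
  from norm_set_integral_le_antiderivative[OF assms this] show ?thesis by simp
qed

lemma tendsto_if_dist_le:
  assumes "(b \<longlongrightarrow> 0) F" and "\<forall>\<^sub>F r in F. dist (f r) l \<le> b r"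
  shows "(f \<longlongrightarrow> l) F"
  unfolding tendsto_dist_iff[of f] using assms(2,1)
  by (intro Lim_null_comparison[of "\<lambda>r. dist (f r) l" b]) auto

lemma heat_semigroup_time_diff_abs:
  fixes f :: "'a::euclidean_space \<Rightarrow> complex"
  assumes "0 < r" "0 < t" and f: "f \<in> bcontfun" and B: "\<And>y. norm (f y) \<le> B"
  shows "norm (heat_semigroup t f x - heat_semigroup r f x) \<le> 2 * B * real DIM('a) * (\<bar>t - r\<bar> / t)"
proof (cases "r \<le> t")
  case True
  then show ?thesis using heat_semigroup_time_diff[OF assms(1) True f B] by simp
next
  case False
  have "0 \<le> B" using B norm_ge_zero order_trans by blast
  moreover have "(r - t) / r \<le> \<bar>t - r\<bar> / t" using assms False by (intro frac_le) auto
  ultimately have "2 * B * real DIM('a) * ((r - t) / r) \<le> 2 * B * real DIM('a) * (\<bar>t - r\<bar> / t)"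
    by (intro mult_left_mono) auto
  with heat_semigroup_time_diff[OF assms(2) _ f B, of r] False show ?thesis
    by (auto simp: norm_minus_commute intro: order_trans)
qed

definition heat_flow :: "('a::euclidean_space \<Rightarrow>\<^sub>C complex) \<Rightarrow> real \<Rightarrow> ('a \<Rightarrow>\<^sub>C complex)" where
  "heat_flow f t = Bcontfun (heat_semigroup t (apply_bcontfun f))"

lemma apply_heat_flow: "t \<ge> 0 \<Longrightarrow> apply_bcontfun (heat_flow f t) = heat_semigroup t (apply_bcontfun f)"
  unfolding heat_flow_def by (intro Bcontfun_inverse heat_semigroup_bcontfun apply_bcontfun)

lemma continuous_on_heat_flow:
  "continuous_on {0<..} (heat_flow (f :: 'a::euclidean_space \<Rightarrow>\<^sub>C complex))"
  unfolding continuous_on_def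
proof
  fix t :: real assume "t \<in> {0<..}"
  then have t: "t > 0" by simp
  have "((\<lambda>r. 2 * norm f * real DIM('a) * (\<bar>t - r\<bar> / t)) \<longlongrightarrow> 2 * norm f * real DIM('a) * (\<bar>t - t\<bar> / t)) (at t within {0<..})"
    by (intro tendsto_intros) (use t in auto)
  then have lim: "((\<lambda>r. 2 * norm f * real DIM('a) * (\<bar>t - r\<bar> / t)) \<longlongrightarrow> 0) (at t within {0<..})"
    by simp
  have "\<forall>\<^sub>F r in at t within {0<..}. dist (heat_flow f r) (heat_flow f t) \<le> 2 * norm f * real DIM('a) * (\<bar>t - r\<bar> / t)"
    unfolding eventually_at_filter
  proof (rule always_eventually, intro allI impI, rule dist_bound)
    fix r x assume "r \<in> {0::real<..}"
    then show "dist (apply_bcontfun (heat_flow f r) x) (apply_bcontfun (heat_flow f t) x)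
        \<le> 2 * norm f * real DIM('a) * (\<bar>t - r\<bar> / t)"
      using heat_semigroup_time_diff_abs[OF _ t apply_bcontfun norm_bounded, of r f x] t
      by (simp add: apply_heat_flow dist_norm norm_minus_commute)
  qed
  then show "(heat_flow f \<longlongrightarrow> heat_flow f t) (at t within {0<..})"
    by (rule tendsto_if_dist_le[OF lim])
qed

lemma norm_heat_semigroup_diff_le:
  fixes f g :: "'a::euclidean_space \<Rightarrow>\<^sub>C complex"
  assumes "t \<ge> 0"
  shows "norm (heat_semigroup t (apply_bcontfun f) x - heat_semigroup t (apply_bcontfun g) x) \<le> norm (f - g)"
proof -
  have "norm (heat_semigroup t (apply_bcontfun (f - g)) x) \<le> norm (f - g)"
    by (intro norm_heat_semigroup_le assms apply_bcontfun norm_bounded)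
  then show ?thesis
    using heat_semigroup_diff[OF assms apply_bcontfun apply_bcontfun, of f g x] by simp
qed

text \<open>The end points are left out: \<open>h\<close> may be discontinuous at \<open>0\<close>, and at \<open>s = t\<close> the estimate of the
  semigroup in time degenerates. Two points do not affect the integrals below.\<close>

lemma continuous_on_heat_semigroup_backward:
  fixes h :: "real \<Rightarrow> 'a::euclidean_space \<Rightarrow>\<^sub>C complex"
  assumes h: "continuous_on {0<..} h"
  shows "continuous_on {0<..<t} (\<lambda>s. heat_semigroup (t - s) (apply_bcontfun (h s)) x)"
  unfolding continuous_on_def
proof
  fix s assume s: "s \<in> {0<..<t}"
  let ?F = "at s within {0<..<t}"
  let ?b = "\<lambda>r. norm (h r - h s) + 2 * norm (h s) * real DIM('a) * (\<bar>(t - s) - (t - r)\<bar> / (t - s))"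
  have "(h \<longlongrightarrow> h s) ?F"
    using h s by (auto simp: continuous_on_def intro: tendsto_within_subset)
  then have "(?b \<longlongrightarrow> norm (h s - h s) + 2 * norm (h s) * real DIM('a) * (\<bar>(t - s) - (t - s)\<bar> / (t - s))) ?F"
    by (intro tendsto_intros) (use s in auto)
  then have lim: "(?b \<longlongrightarrow> 0) ?F" by simp
  have "\<forall>\<^sub>F r in ?F. dist (heat_semigroup (t - r) (apply_bcontfun (h r)) x)
      (heat_semigroup (t - s) (apply_bcontfun (h s)) x) \<le> ?b r"
    unfolding eventually_at_filter
  proof (rule always_eventually, intro allI impI)
    fix r assume r: "r \<in> {0<..<t}"
    show "dist (heat_semigroup (t - r) (apply_bcontfun (h r)) x)
      (heat_semigroup (t - s) (apply_bcontfun (h s)) x) \<le> ?b r"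
      unfolding dist_norm
    proof (rule norm_diff_triangle_le)
      show "norm (heat_semigroup (t - r) (apply_bcontfun (h r)) x - heat_semigroup (t - r) (apply_bcontfun (h s)) x)
          \<le> norm (h r - h s)"
        using r by (intro norm_heat_semigroup_diff_le) auto
      show "norm (heat_semigroup (t - r) (apply_bcontfun (h s)) x - heat_semigroup (t - s) (apply_bcontfun (h s)) x)
          \<le> 2 * norm (h s) * real DIM('a) * (\<bar>(t - s) - (t - r)\<bar> / (t - s))"
        using r s by (subst norm_minus_commute)
          (intro heat_semigroup_time_diff_abs apply_bcontfun norm_bounded; simp)
    qed
  qed
  then show "((\<lambda>s. heat_semigroup (t - s) (apply_bcontfun (h s)) x) \<longlongrightarrow>
      heat_semigroup (t - s) (apply_bcontfun (h s)) x) ?F"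
    by (rule tendsto_if_dist_le[OF lim])
qed

section \<open>The Duhamel integral\<close>

definition duhamel :: "(real \<Rightarrow> 'a::euclidean_space \<Rightarrow>\<^sub>C complex) \<Rightarrow> real \<Rightarrow> 'a \<Rightarrow> complex" where
  "duhamel h t x = (LINT s:{0..t}|lborel. heat_semigroup (t - s) (apply_bcontfun (h s)) x)"

lemma set_integrable_duhamel:
  fixes h :: "real \<Rightarrow> 'a::euclidean_space \<Rightarrow>\<^sub>C complex"
  assumes h: "continuous_on {0<..} h" and C: "\<And>s. norm (h s) \<le> C"
  shows "set_integrable lborel {0..t} (\<lambda>s. heat_semigroup (t - s) (apply_bcontfun (h s)) x)"
proof -
  have "set_integrable lborel {0<..<t} (\<lambda>s. heat_semigroup (t - s) (apply_bcontfun (h s)) x)"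
  proof (rule set_integrable_bound)
    show "set_integrable lborel {0<..<t} (\<lambda>s. C)"
      by (cases "t \<le> 0") (simp_all add: set_integrable_def)
    show "set_borel_measurable lborel {0<..<t} (\<lambda>s. heat_semigroup (t - s) (apply_bcontfun (h s)) x)"
      using set_measurable_continuous_on[OF _ continuous_on_heat_semigroup_backward[OF h]]
      by (simp add: set_borel_measurable_def)
    have "0 \<le> C" using C norm_ge_zero order_trans by blast
    then show "AE s in lborel. s \<in> {0<..<t} \<longrightarrow>
        norm (heat_semigroup (t - s) (apply_bcontfun (h s)) x) \<le> norm C"
      by (auto intro!: norm_heat_semigroup_le apply_bcontfun order_trans[OF norm_bounded C])
  qed
  then show ?thesis
    by (subst set_integrable_discrete_difference[where X = "{0, t}" and B = "{0<..<t}"]) auto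
qed

lemma norm_duhamel_le:
  fixes h :: "real \<Rightarrow> 'a::euclidean_space \<Rightarrow>\<^sub>C complex"
  assumes h: "continuous_on {0<..} h" and C: "\<And>s. norm (h s) \<le> C" and t: "t \<ge> 0"
  shows "norm (duhamel h t x) \<le> C * t"
proof -
  have "norm (duhamel h t x) \<le> C * t ^ Suc 0 / fact (Suc 0)"
    unfolding duhamel_def
  proof (rule norm_set_integral_le_power[OF t])
    show "set_integrable lborel {0..t} (\<lambda>s. heat_semigroup (t - s) (apply_bcontfun (h s)) x)"
      by (rule set_integrable_duhamel[OF h C])
    show "norm (heat_semigroup (t - s) (apply_bcontfun (h s)) x) \<le> C * s ^ 0 / fact 0" if "s \<in> {0..t}" for s
      using that by (auto intro!: norm_heat_semigroup_le apply_bcontfun order_trans[OF norm_bounded C])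
  qed
  then show ?thesis by simp
qed

lemma norm_duhamel_diff_le_power:
  fixes h k :: "real \<Rightarrow> 'a::euclidean_space \<Rightarrow>\<^sub>C complex"
  assumes h: "continuous_on {0<..} h" "\<And>s. norm (h s) \<le> C"
    and k: "continuous_on {0<..} k" "\<And>s. norm (k s) \<le> C" and t: "t \<ge> 0"
    and le: "\<And>s. s \<in> {0..t} \<Longrightarrow> norm (h s - k s) \<le> c * s ^ n / fact n"
  shows "norm (duhamel h t x - duhamel k t x) \<le> c * t ^ Suc n / fact (Suc n)"
proof -
  note int = set_integrable_duhamel[OF h, of t x] set_integrable_duhamel[OF k, of t x]
  have "norm (LINT s:{0..t}|lborel. heat_semigroup (t - s) (apply_bcontfun (h s)) x
      - heat_semigroup (t - s) (apply_bcontfun (k s)) x) \<le> c * t ^ Suc n / fact (Suc n)"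
    by (intro norm_set_integral_le_power set_integral_diff int t order_trans[OF norm_heat_semigroup_diff_le le])
       auto
  then show ?thesis
    unfolding duhamel_def by (simp add: set_integral_diff(2)[OF int])
qed

lemma continuous_on_duhamel_space:
  fixes h :: "real \<Rightarrow> 'a::euclidean_space \<Rightarrow>\<^sub>C complex"
  assumes h: "continuous_on {0<..} h" and C: "\<And>s. norm (h s) \<le> C"
  shows "continuous_on UNIV (duhamel h t)"
  unfolding continuous_on_sequentially
proof (intro allI ballI impI, elim conjE)
  fix X :: "nat \<Rightarrow> 'a" and a assume lim: "X \<longlonglongrightarrow> a"
  show "(duhamel h t \<circ> X) \<longlonglongrightarrow> duhamel h t a"
    unfolding o_def duhamel_def set_lebesgue_integral_def
  proof (rule integral_dominated_convergence[where w = "\<lambda>s. indicator {0..t} s *\<^sub>R C"])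
    show "integrable lborel (\<lambda>s. indicator {0..t} s *\<^sub>R C)"
      by (cases "t < 0") simp_all
    show "(\<lambda>s. indicator {0..t} s *\<^sub>R heat_semigroup (t - s) (apply_bcontfun (h s)) y) \<in> borel_measurable lborel" for y
      using set_integrable_duhamel[OF h C, of t y] unfolding set_integrable_def
      by (rule borel_measurable_integrable)
    then show "(\<lambda>s. indicator {0..t} s *\<^sub>R heat_semigroup (t - s) (apply_bcontfun (h s)) (X i)) \<in> borel_measurable lborel" for i .
    show "AE s in lborel. (\<lambda>i. indicator {0..t} s *\<^sub>R heat_semigroup (t - s) (apply_bcontfun (h s)) (X i))
        \<longlonglongrightarrow> indicator {0..t} s *\<^sub>R heat_semigroup (t - s) (apply_bcontfun (h s)) a"
    proof (rule AE_I2)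
      fix s
      show "(\<lambda>i. indicator {0..t} s *\<^sub>R heat_semigroup (t - s) (apply_bcontfun (h s)) (X i))
        \<longlonglongrightarrow> indicator {0..t} s *\<^sub>R heat_semigroup (t - s) (apply_bcontfun (h s)) a"
      proof (cases "s \<in> {0..t}")
        case True
        then have "isCont (heat_semigroup (t - s) (apply_bcontfun (h s))) a"
          using continuous_on_heat_semigroup[OF _ apply_bcontfun, of "t - s" "h s"]
          by (simp add: continuous_on_eq_continuous_at)
        then show ?thesis
          by (intro tendsto_intros isCont_tendsto_compose[OF _ lim])
      qed simp
    qed
    show "AE s in lborel. norm (indicator {0..t} s *\<^sub>R heat_semigroup (t - s) (apply_bcontfun (h s)) (X i))
        \<le> indicator {0..t} s *\<^sub>R C" for i
      by (auto simp: indicator_def intro!: norm_heat_semigroup_le apply_bcontfun order_trans[OF norm_bounded C])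
  qed
qed

lemma duhamel_bcontfun:
  fixes h :: "real \<Rightarrow> 'a::euclidean_space \<Rightarrow>\<^sub>C complex"
  assumes "continuous_on {0<..} h" "\<And>s. norm (h s) \<le> C" "t \<ge> 0"
  shows "duhamel h t \<in> bcontfun"
  using continuous_on_duhamel_space[OF assms(1,2)] norm_duhamel_le[OF assms]
  by (rule bcontfun_normI)

text \<open>The integrals up to \<open>r\<close> and \<open>t\<close> differ by an integral over \<open>[r,t]\<close> and by the change of the
  semigroup on \<open>[0,r]\<close>. The latter is of order \<open>q = (t - r) / (t - s)\<close>. Replacing \<open>q\<close> by the larger
  \<open>sqrt q\<close> leaves an integrable singularity in \<open>s\<close> and gives a square root of \<open>t - r\<close>.\<close>

lemma duhamel_time_diff:
  fixes h :: "real \<Rightarrow> 'a::euclidean_space \<Rightarrow>\<^sub>C complex"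
  assumes h: "continuous_on {0<..} h" and C: "\<And>s. norm (h s) \<le> C" and rt: "0 \<le> r" "r < t"
  shows "norm (duhamel h t x - duhamel h r x) \<le> 4 * C * real DIM('a) * sqrt (t - r) * sqrt t + C * (t - r)"
proof -
  let ?f = "\<lambda>t s. heat_semigroup (t - s) (apply_bcontfun (h s)) x"
  define D where "D = 2 * C * real DIM('a) * sqrt (t - r)"
  have C0: "0 \<le> C" using C norm_ge_zero order_trans by blast
  have d1: "1 \<le> real DIM('a)" using DIM_positive[where 'a='a] by linarith
  have sqrt_ge: "q \<le> sqrt q" if "0 < q" "q \<le> 1" for q :: real
    using that by (intro real_le_rsqrt) (simp add: power2_eq_square mult_left_le)
  have bd: "norm (?f t s) \<le> C" if "s \<le> t" for s t
    using that by (intro norm_heat_semigroup_le apply_bcontfun order_trans[OF norm_bounded C]) auto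
  have int: "set_integrable lborel {0..r} (?f t)" "set_integrable lborel {r..t} (?f t)"
    "set_integrable lborel {0..r} (?f r)"
    using set_integrable_duhamel[OF h C, of t x] set_integrable_duhamel[OF h C, of r x] rt
    by (auto intro: set_integrable_subset)
  have "duhamel h t x = (LINT s:{0..r}|lborel. ?f t s) + (LINT s:{r..t}|lborel. ?f t s)"
  proof -
    have "{0..t} = {0..r} \<union> {r..t}" using rt by auto
    moreover have "AE s in lborel. \<not> (s \<in> {0..r} \<and> s \<in> {r..t})"
      using AE_lborel_singleton[of r] by eventually_elim auto
    ultimately show ?thesis
      unfolding duhamel_def using int by (simp add: set_integral_Un_AE)
  qed
  then have "duhamel h t x - duhamel h r x
      = (LINT s:{0..r}|lborel. ?f t s - ?f r s) + (LINT s:{r..t}|lborel. ?f t s)"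
    unfolding duhamel_def by (simp add: set_integral_diff(2)[OF int(1) int(3)])
  moreover have "norm (LINT s:{r..t}|lborel. ?f t s) \<le> C * t - C * r"
    using rt bd by (intro norm_set_integral_le_antiderivative[where p = "\<lambda>_. C"] int)
      (auto intro!: derivative_eq_intros)
  moreover have "norm (LINT s:{0..r}|lborel. ?f t s - ?f r s) \<le> - 2 * D * sqrt (t - r) - (- 2 * D * sqrt (t - 0))"
  proof (rule norm_set_integral_le_antiderivative[where p = "\<lambda>s. D / sqrt (t - s)"])
    fix s assume s: "s \<in> {0..r}"
    show "((\<lambda>s. - 2 * D * sqrt (t - s)) has_real_derivative D / sqrt (t - s)) (at s within {0..r})"
      using s rt by (auto intro!: derivative_eq_intros simp: field_simps)
    let ?q = "(t - r) / (t - s)"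
    have q: "0 < ?q" "?q \<le> 1" using s rt by auto
    have "norm (?f t s - ?f r s) \<le> 2 * C * real DIM('a) * ?q"
    \<comment> \<open>At \<open>s = r\<close> the earlier semigroup is the identity, and only the trivial bound \<open>2C\<close> is available.\<close>
    proof (cases "s = r")
      case True
      have "norm (?f t s - ?f r s) \<le> C + C"
        using s rt by (intro order_trans[OF norm_triangle_ineq4] add_mono bd) auto
      also have "\<dots> \<le> 2 * C * real DIM('a)" using mult_left_mono[OF d1, of "2 * C"] C0 by simp
      finally show ?thesis using True rt by simp
    next
      case False
      then show ?thesis
        using heat_semigroup_time_diff[of "r - s" "t - s" "apply_bcontfun (h s)" C x] s rt
        by (auto intro!: apply_bcontfun order_trans[OF norm_bounded C])
    qed
    also have "\<dots> \<le> 2 * C * real DIM('a) * sqrt ?q"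
      by (rule mult_left_mono[OF sqrt_ge[OF q]]) (use C0 in simp)
    also have "\<dots> = D / sqrt (t - s)"
      by (simp add: D_def real_sqrt_divide)
    finally show "norm (?f t s - ?f r s) \<le> D / sqrt (t - s)" .
  qed (use rt int in auto)
  moreover have "0 \<le> D * sqrt (t - r)" using rt C0 by (simp add: D_def)
  ultimately have "norm (duhamel h t x - duhamel h r x) \<le> 2 * D * sqrt t + (C * t - C * r)"
    using norm_triangle_ineq[of "LINT s:{0..r}|lborel. ?f t s - ?f r s" "LINT s:{r..t}|lborel. ?f t s"]
    by simp
  then show ?thesis by (simp add: D_def algebra_simps)
qed

definition duhamel_flow :: "(real \<Rightarrow> 'a::euclidean_space \<Rightarrow>\<^sub>C complex) \<Rightarrow> real \<Rightarrow> ('a \<Rightarrow>\<^sub>C complex)" where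
  "duhamel_flow h t = Bcontfun (duhamel h t)"

lemma apply_duhamel_flow:
  assumes "continuous_on {0<..} h" "\<And>s. norm (h s) \<le> C" "t \<ge> 0"
  shows "apply_bcontfun (duhamel_flow h t) = duhamel h t"
  unfolding duhamel_flow_def by (intro Bcontfun_inverse duhamel_bcontfun[OF assms])

lemma continuous_on_duhamel_flow:
  fixes h :: "real \<Rightarrow> 'a::euclidean_space \<Rightarrow>\<^sub>C complex"
  assumes h: "continuous_on {0<..} h" and C: "\<And>s. norm (h s) \<le> C"
  shows "continuous_on {0<..} (duhamel_flow h)"
  unfolding continuous_on_def
proof
  fix t :: real assume "t \<in> {0<..}"
  then have t: "t > 0" by simp
  let ?F = "at t within {0<..}"
  let ?b = "\<lambda>r. 4 * C * real DIM('a) * sqrt \<bar>t - r\<bar> * sqrt (max t r) + C * \<bar>t - r\<bar>"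
  have "(?b \<longlongrightarrow> 4 * C * real DIM('a) * sqrt \<bar>t - t\<bar> * sqrt (max t t) + C * \<bar>t - t\<bar>) ?F"
    by (intro tendsto_intros)
  then have lim: "(?b \<longlongrightarrow> 0) ?F" by simp
  have "dist (duhamel_flow h r) (duhamel_flow h t) \<le> ?b r" if "r > 0" for r
  proof (rule dist_bound)
    fix x
    consider "r < t" | "r = t" | "t < r" by linarith
    then show "dist (apply_bcontfun (duhamel_flow h r) x) (apply_bcontfun (duhamel_flow h t) x) \<le> ?b r"
      using that t duhamel_time_diff[OF h C, of r t x] duhamel_time_diff[OF h C, of t r x]
      by cases (auto simp: apply_duhamel_flow[OF h C] dist_norm norm_minus_commute)
  qed
  then have "\<forall>\<^sub>F r in ?F. dist (duhamel_flow h r) (duhamel_flow h t) \<le> ?b r"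
    unfolding eventually_at_filter by (auto intro!: always_eventually)
  then show "(duhamel_flow h \<longlongrightarrow> duhamel_flow h t) ?F"
    by (rule tendsto_if_dist_le[OF lim])
qed

section \<open>Bounded Lipschitz nonlinearities\<close>

instance bcontfun :: (metric_space, banach) banach ..

text \<open>The Nemytskii (superposition) operator of \<open>G\<close>. It makes sense only if \<open>G\<close> composed with \<open>w\<close>
  is bounded and continuous, which the following locale ensures.\<close>

definition nemytskii :: "(complex \<Rightarrow> complex) \<Rightarrow> ('a::topological_space \<Rightarrow>\<^sub>C complex) \<Rightarrow> ('a \<Rightarrow>\<^sub>C complex)" where
  "nemytskii G w = Bcontfun (\<lambda>x. G (apply_bcontfun w x))"

locale bounded_lipschitz =
  fixes G :: "complex \<Rightarrow> complex" and K C :: real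
  assumes lipschitz: "norm (G z - G w) \<le> K * norm (z - w)"
    and norm_le: "norm (G z) \<le> C"
begin

lemma K_nonneg: "K \<ge> 0"
  using order_trans[OF norm_ge_zero lipschitz[of 1 0]] by simp

lemma C_nonneg: "C \<ge> 0"
  using order_trans[OF norm_ge_zero norm_le] .

lemma continuous_on_nonlinearity: "continuous_on A G"
proof -
  have "K-lipschitz_on A G"
    using lipschitz K_nonneg by (intro lipschitz_onI) (auto simp: dist_norm)
  then show ?thesis by (rule lipschitz_on_continuous_on)
qed

lemma comp_bcontfun: "(\<lambda>x. G (apply_bcontfun w x)) \<in> bcontfun"
  by (intro bcontfun_normI[of _ C] norm_le continuous_on_compose2[OF continuous_on_nonlinearity[of UNIV]]) auto

lemma apply_nemytskii [simp]: "apply_bcontfun (nemytskii G w) = (\<lambda>x. G (apply_bcontfun w x))"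
  unfolding nemytskii_def by (rule Bcontfun_inverse[OF comp_bcontfun])

lemma norm_nemytskii_le: "norm (nemytskii G w) \<le> C"
  by (rule norm_bound) (simp add: norm_le)

lemma norm_nemytskii_diff_le: "norm (nemytskii G v - nemytskii G w) \<le> K * norm (v - w)"
proof (rule norm_bound)
  fix x
  have "norm (apply_bcontfun v x - apply_bcontfun w x) \<le> norm (v - w)"
    using norm_bounded[of "v - w" x] by simp
  then show "norm (apply_bcontfun (nemytskii G v - nemytskii G w) x) \<le> K * norm (v - w)"
    using K_nonneg by (auto intro: order_trans[OF lipschitz mult_left_mono])
qed

lemma continuous_on_nemytskii:
  assumes "continuous_on A w"
  shows "continuous_on A (\<lambda>s. nemytskii G (w s))"
proof (rule continuous_on_compose2[OF _ assms subset_UNIV])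
  have "K-lipschitz_on UNIV (nemytskii G)"
    using norm_nemytskii_diff_le K_nonneg by (intro lipschitz_onI) (auto simp: dist_norm)
  then show "continuous_on UNIV (nemytskii G)" by (rule lipschitz_on_continuous_on)
qed

lemma norm_duhamel_flow_diff_le_power:
  fixes v w :: "real \<Rightarrow> ('a::euclidean_space \<Rightarrow>\<^sub>C complex)"
  assumes v: "continuous_on {0<..} v" and w: "continuous_on {0<..} w" and t: "t \<ge> 0"
    and le: "\<And>s. s \<in> {0..t} \<Longrightarrow> norm (v s - w s) \<le> c * s ^ n / fact n"
  shows "norm (duhamel_flow (\<lambda>s. nemytskii G (v s)) t - duhamel_flow (\<lambda>s. nemytskii G (w s)) t)
    \<le> K * c * t ^ Suc n / fact (Suc n)"
proof (rule norm_bound)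
  fix x
  note h = continuous_on_nemytskii[OF v] norm_nemytskii_le
  note k = continuous_on_nemytskii[OF w] norm_nemytskii_le
  have "norm (nemytskii G (v s) - nemytskii G (w s)) \<le> K * c * s ^ n / fact n" if "s \<in> {0..t}" for s
    using order_trans[OF norm_nemytskii_diff_le mult_left_mono[OF le[OF that] K_nonneg]] by (simp add: mult.assoc)
  from norm_duhamel_diff_le_power[OF h k t this]
  show "norm (apply_bcontfun (duhamel_flow (\<lambda>s. nemytskii G (v s)) t - duhamel_flow (\<lambda>s. nemytskii G (w s)) t) x)
    \<le> K * c * t ^ Suc n / fact (Suc n)"
    by (simp add: apply_duhamel_flow[OF h t] apply_duhamel_flow[OF k t])
qed

primrec picard :: "('a::euclidean_space \<Rightarrow>\<^sub>C complex) \<Rightarrow> nat \<Rightarrow> real \<Rightarrow> ('a \<Rightarrow>\<^sub>C complex)" where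
  "picard g 0 = heat_flow g"
| "picard g (Suc n) = (\<lambda>t. heat_flow g t + duhamel_flow (\<lambda>s. nemytskii G (picard g n s)) t)"

lemma continuous_on_picard: "continuous_on {0<..} (picard g n)"
  by (induction n)
    (auto intro!: continuous_on_heat_flow continuous_on_add continuous_on_duhamel_flow[where C = C]
      continuous_on_nemytskii norm_nemytskii_le simp del: apply_nemytskii)

lemma norm_picard_step_le:
  "t \<ge> 0 \<Longrightarrow> norm (picard g (Suc n) t - picard g n t) \<le> C * K ^ n * t ^ Suc n / fact (Suc n)"
proof (induction n arbitrary: t)
  case 0
  note h = continuous_on_nemytskii[OF continuous_on_heat_flow] norm_nemytskii_le
  have "norm (duhamel_flow (\<lambda>s. nemytskii G (heat_flow g s)) t) \<le> C * t"
    using norm_duhamel_le[OF h 0] by (intro norm_bound) (simp add: apply_duhamel_flow[OF h 0])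
  then show ?case by simp
next
  case (Suc n)
  have "norm (duhamel_flow (\<lambda>s. nemytskii G (picard g (Suc n) s)) t - duhamel_flow (\<lambda>s. nemytskii G (picard g n s)) t)
      \<le> K * (C * K ^ n) * t ^ Suc (Suc n) / fact (Suc (Suc n))"
    by (intro norm_duhamel_flow_diff_le_power continuous_on_picard Suc) auto
  then show ?case by (simp add: mult_ac)
qed

lemma summable_picard_bound: "summable (\<lambda>n. C * K ^ n * t ^ Suc n / fact n)"
proof -
  have "summable (\<lambda>n. C * t * (inverse (fact n) * (K * t) ^ n))"
    by (intro summable_mult summable_exp)
  then show ?thesis by (simp add: field_simps power_mult_distrib)
qed

text \<open>The increments of the Picard iteration are dominated by an exponential series, uniformly on
  bounded time intervals. So the iteration has a limit for all times, without a restart on short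
  intervals, and continuity in time carries over to the limit.\<close>

lemma exists_mild_flow:
  fixes g :: "'a::euclidean_space \<Rightarrow>\<^sub>C complex"
  obtains U where "continuous_on {0<..} U"
    and "\<And>t. t \<ge> 0 \<Longrightarrow> U t = heat_flow g t + duhamel_flow (\<lambda>s. nemytskii G (U s)) t"
proof -
  define U where "U t = heat_flow g t + (\<Sum>n. picard g (Suc n) t - picard g n t)" for t
  have lim: "uniform_limit {0..T} (picard g) U sequentially" for T
  proof -
    have "uniform_limit {0..T} (\<lambda>n t. \<Sum>i<n. picard g (Suc i) t - picard g i t)
        (\<lambda>t. \<Sum>n. picard g (Suc n) t - picard g n t) sequentially"
    proof (rule Weierstrass_m_test[OF _ summable_picard_bound[of T]])
      fix n t assume t: "t \<in> {0..T}"
      have "norm (picard g (Suc n) t - picard g n t) \<le> C * K ^ n * t ^ Suc n / fact (Suc n)"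
        using t by (intro norm_picard_step_le) simp
      also have "\<dots> \<le> C * K ^ n * T ^ Suc n / fact n"
        using t C_nonneg K_nonneg
        by (intro frac_le mult_left_mono power_mono mult_nonneg_nonneg zero_le_power fact_mono) auto
      finally show "norm (picard g (Suc n) t - picard g n t) \<le> C * K ^ n * T ^ Suc n / fact n" .
    qed
    moreover have "(\<Sum>i<n. picard g (Suc i) t - picard g i t) = picard g n t - heat_flow g t" for n t
      using sum_lessThan_telescope[of "\<lambda>i. picard g i t" n] by simp
    ultimately have "uniform_limit {0..T} (\<lambda>n t. heat_flow g t + (picard g n t - heat_flow g t)) U sequentially"
      unfolding U_def by (intro uniform_limit_intros) simp
    then show ?thesis by simp
  qed
  have cont: "continuous_on {0<..} U"
  proof -
    have "isCont U t" if "t > 0" for t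
    proof -
      have "uniform_limit {0<..<t + 1} (picard g) U sequentially"
        by (rule uniform_limit_on_subset[OF lim[of "t + 1"]]) auto
      then have "continuous_on {0<..<t + 1} U"
        by (rule uniform_limit_theorem[rotated])
          (auto intro!: always_eventually continuous_on_subset[OF continuous_on_picard])
      then show ?thesis using that by (simp add: continuous_on_eq_continuous_at)
    qed
    then show ?thesis by (auto intro: continuous_at_imp_continuous_on)
  qed
  have "U t = heat_flow g t + duhamel_flow (\<lambda>s. nemytskii G (U s)) t" if t: "t \<ge> 0" for t
  proof -
    let ?\<Phi> = "\<lambda>w. duhamel_flow (\<lambda>s. nemytskii G (w s)) t"
    have "(\<lambda>n. ?\<Phi> (picard g n)) \<longlonglongrightarrow> ?\<Phi> U"
    proof (rule tendstoI)
      fix e :: real assume e: "e > 0"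
      define d where "d = e / (K * t + 1)"
      have pos: "K * t + 1 > 0" using mult_nonneg_nonneg[OF K_nonneg t] by linarith
      then have d: "d > 0" using e by (simp add: d_def)
      have "d * (K * t + 1) = e" using pos by (simp add: d_def)
      then have de: "K * d * t < e" using d by (simp add: algebra_simps)
      show "\<forall>\<^sub>F n in sequentially. dist (?\<Phi> (picard g n)) (?\<Phi> U) < e"
        using uniform_limitD[OF lim[of t] d]
      proof eventually_elim
        case (elim n)
        have "norm (?\<Phi> (picard g n) - ?\<Phi> U) \<le> K * d * t ^ Suc 0 / fact (Suc 0)"
          using elim by (intro norm_duhamel_flow_diff_le_power continuous_on_picard cont t)
            (auto simp: dist_norm less_imp_le)
        then show ?case using de by (simp add: dist_norm)
      qed
    qed
    then have "(\<lambda>n. picard g (Suc n) t) \<longlonglongrightarrow> heat_flow g t + ?\<Phi> U"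
      by (auto intro: tendsto_intros)
    moreover have "(\<lambda>n. picard g (Suc n) t) \<longlonglongrightarrow> U t"
      using tendsto_uniform_limitI[OF lim[of t], of t] t by (intro LIMSEQ_Suc) simp
    ultimately show ?thesis using LIMSEQ_unique by blast
  qed
  with cont that show ?thesis by blast
qed

text \<open>Boundedness of \<open>G\<close> alone bounds the difference of two solutions linearly in time, and each further
  use of the Duhamel formula improves this by a factor \<open>K t / (n + 2)\<close>.\<close>

lemma mild_flow_unique:
  fixes u v :: "real \<Rightarrow> ('a::euclidean_space \<Rightarrow>\<^sub>C complex)"
  assumes int: "\<And>t x. t \<in> A \<Longrightarrow> set_integrable lborel {0..t} (\<lambda>s. heat_semigroup (t - s) (\<lambda>y. G (apply_bcontfun (u s) y)) x)"
      "\<And>t x. t \<in> A \<Longrightarrow> set_integrable lborel {0..t} (\<lambda>s. heat_semigroup (t - s) (\<lambda>y. G (apply_bcontfun (v s) y)) x)"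
    and eq: "\<And>t x. t \<in> A \<Longrightarrow> apply_bcontfun (u t) x = heat_semigroup t g x +
        (LINT s:{0..t}|lborel. heat_semigroup (t - s) (\<lambda>y. G (apply_bcontfun (u s) y)) x)"
      "\<And>t x. t \<in> A \<Longrightarrow> apply_bcontfun (v t) x = heat_semigroup t g x +
        (LINT s:{0..t}|lborel. heat_semigroup (t - s) (\<lambda>y. G (apply_bcontfun (v s) y)) x)"
    and A: "\<And>t. t \<in> A \<Longrightarrow> t \<ge> 0" "\<And>t. t \<in> A \<Longrightarrow> {0..t} \<subseteq> A" and t: "t \<in> A"
  shows "u t = v t"
proof (rule bcontfun_eqI)
  fix x
  define d where "d s y = G (apply_bcontfun (u s) y) - G (apply_bcontfun (v s) y)" for s y
  have diff: "apply_bcontfun (u t) x - apply_bcontfun (v t) x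
      = (LINT s:{0..t}|lborel. heat_semigroup (t - s) (d s) x)"
    "set_integrable lborel {0..t} (\<lambda>s. heat_semigroup (t - s) (d s) x)" if "t \<in> A" for t x
  proof -
    have *: "heat_semigroup (t - s) (d s) x = heat_semigroup (t - s) (\<lambda>y. G (apply_bcontfun (u s) y)) x
        - heat_semigroup (t - s) (\<lambda>y. G (apply_bcontfun (v s) y)) x" if "s \<in> {0..t}" for s
      unfolding d_def using that by (intro heat_semigroup_diff comp_bcontfun) simp
    show "set_integrable lborel {0..t} (\<lambda>s. heat_semigroup (t - s) (d s) x)"
      using set_integral_diff(1)[OF int(1)[OF that, of x] int(2)[OF that, of x]]
      by (subst set_integrable_cong[OF refl refl *])
    show "apply_bcontfun (u t) x - apply_bcontfun (v t) x
      = (LINT s:{0..t}|lborel. heat_semigroup (t - s) (d s) x)"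
      using set_integral_diff(2)[OF int(1)[OF that, of x] int(2)[OF that, of x]] * eq[OF that]
      by (subst set_lebesgue_integral_cong[of "{0..t}" _ "\<lambda>s. heat_semigroup (t - s) (d s) x"]) auto
  qed
  have step: "norm (apply_bcontfun (u t) x - apply_bcontfun (v t) x) \<le> c * t ^ Suc n / fact (Suc n)"
    if t: "t \<in> A" and le: "\<And>s y. s \<in> {0..t} \<Longrightarrow> norm (d s y) \<le> c * s ^ n / fact n" for t x c n
    unfolding diff(1)[OF t]
  proof (rule norm_set_integral_le_power[OF A(1) diff(2)])
    show "norm (heat_semigroup (t - s) (d s) x) \<le> c * s ^ n / fact n" if "s \<in> {0..t}" for s
      using that le[OF that] unfolding d_def
      by (intro norm_heat_semigroup_le minus_cont comp_bcontfun) auto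
  qed (fact t)+
  have bound: "norm (apply_bcontfun (u t) x - apply_bcontfun (v t) x) \<le> 2 * C * K ^ n * t ^ Suc n / fact (Suc n)"
    if "t \<in> A" for n t x using that
  proof (induction n arbitrary: t x)
    case 0
    have "norm (d s y) \<le> 2 * C" for s y
      unfolding d_def mult_2 by (rule order_trans[OF norm_triangle_ineq4 add_mono[OF norm_le norm_le]])
    then have "norm (apply_bcontfun (u t) x - apply_bcontfun (v t) x) \<le> 2 * C * t ^ Suc 0 / fact (Suc 0)"
      using 0 by (intro step) simp_all
    then show ?case by simp
  next
    case (Suc n)
    have "norm (d s y) \<le> K * (2 * C * K ^ n) * s ^ Suc n / fact (Suc n)" if "s \<in> {0..t}" for s y
    proof -
      have "norm (d s y) \<le> K * norm (apply_bcontfun (u s) y - apply_bcontfun (v s) y)"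
        unfolding d_def by (rule lipschitz)
      also have "\<dots> \<le> K * (2 * C * K ^ n * s ^ Suc n / fact (Suc n))"
        using A(2)[OF Suc.prems] that by (intro mult_left_mono Suc.IH K_nonneg) auto
      finally show ?thesis by (simp add: mult.assoc)
    qed
    from step[OF Suc.prems this] show ?case by (simp add: mult_ac)
  qed
  have "(\<lambda>n. 2 * (C * K ^ n * t ^ Suc n / fact n)) \<longlonglongrightarrow> 2 * 0"
    by (intro tendsto_intros summable_LIMSEQ_zero summable_picard_bound)
  moreover have "norm (apply_bcontfun (u t) x - apply_bcontfun (v t) x) \<le> 2 * (C * K ^ n * t ^ Suc n / fact n)" for n
  proof -
    have "2 * C * K ^ n * t ^ Suc n / fact (Suc n) \<le> 2 * C * K ^ n * t ^ Suc n / fact n"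
      using A(1)[OF t] C_nonneg K_nonneg
      by (intro divide_left_mono mult_nonneg_nonneg zero_le_power fact_mono) auto
    with bound[OF t, of x n] show ?thesis by (simp add: mult.assoc)
  qed
  ultimately have "norm (apply_bcontfun (u t) x - apply_bcontfun (v t) x) \<le> 2 * 0"
    by (intro LIMSEQ_le_const) auto
  then show "apply_bcontfun (u t) x = apply_bcontfun (v t) x" by simp
qed

end

section \<open>Dirichlet series in the half-plane of absolute convergence\<close>

lemma summable_Suc_powr: "\<sigma> > 1 \<Longrightarrow> summable (\<lambda>n. real (Suc n) powr (-\<sigma>))"
  using summable_real_powr_iff[of "-\<sigma>"] summable_Suc_iff[of "\<lambda>n. real n powr (-\<sigma>)"] by simp

lemma Re_riemann_zeta:
  assumes "\<sigma> > 1"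
  shows "Re (riemann_zeta (of_real \<sigma>)) = (\<Sum>n. real (Suc n) powr (-\<sigma>))"
proof -
  have "1 * of_nat (Suc n) powr (- complex_of_real \<sigma>) = complex_of_real (real (Suc n) powr (-\<sigma>))" for n
    using powr_of_real[of "real (Suc n)" "-\<sigma>"] by simp
  then have "riemann_zeta (of_real \<sigma>) = (\<Sum>n. complex_of_real (real (Suc n) powr (-\<sigma>)))"
    using assms by (simp add: riemann_zeta_def dirichlet_L_def dirichlet_series_def)
  then show ?thesis
    using suminf_of_real[OF summable_Suc_powr[OF assms], where 'a = complex] by (metis Re_complex_of_real)
qed

lemma norm_dirichlet_term_le:
  assumes "norm (chi (Suc n)) \<le> 1"
  shows "norm (chi (Suc n) * of_nat (Suc n) powr (-s)) \<le> real (Suc n) powr (- Re s)"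
proof -
  have "norm (of_nat (Suc n) powr (-s)) = real (Suc n) powr (- Re s)"
    using norm_powr_real_powr[of "of_nat (Suc n)" "-s"] by simp
  then show ?thesis
    using mult_right_mono[OF assms, of "real (Suc n) powr (- Re s)"] by (simp add: norm_mult)
qed

lemma summable_dirichlet_series:
  assumes "\<And>n. norm (chi (Suc n)) \<le> 1" "Re s > 1"
  shows "summable (\<lambda>n. chi (Suc n) * of_nat (Suc n) powr (-s))"
  by (rule summable_comparison_test[OF _ summable_Suc_powr[OF assms(2)]])
    (use norm_dirichlet_term_le[of chi, OF assms(1)] in blast)

lemma
  assumes chi: "\<And>n. norm (chi (Suc n)) \<le> 1" and s: "1 < \<sigma>" "\<sigma> \<le> Re s"
  shows norm_dirichlet_series_le: "norm (dirichlet_series chi s) \<le> Re (riemann_zeta (of_real \<sigma>))"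
    and norm_dirichlet_series_diff_le:
      "norm (dirichlet_series chi s - chi 1) \<le> Re (riemann_zeta (of_real \<sigma>)) - 1"
proof -
  let ?f = "\<lambda>n. chi (Suc n) * of_nat (Suc n) powr (-s)"
  have le: "norm (?f n) \<le> real (Suc n) powr (-\<sigma>)" for n
    using s by (intro order_trans[OF norm_dirichlet_term_le[of chi, OF chi]] powr_mono) auto
  note sum = summable_Suc_powr[OF s(1)]
  note sumf = summable_dirichlet_series[of chi s, OF chi less_le_trans[OF s]]
  show "norm (dirichlet_series chi s) \<le> Re (riemann_zeta (of_real \<sigma>))"
    unfolding dirichlet_series_def Re_riemann_zeta[OF s(1)]
    by (rule norm_suminf_le[OF le sum])
  have "dirichlet_series chi s - chi 1 = (\<Sum>n. ?f (Suc n))"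
    unfolding dirichlet_series_def using suminf_split_head[OF sumf] by simp
  also have "norm \<dots> \<le> (\<Sum>n. real (Suc (Suc n)) powr (-\<sigma>))"
    by (rule norm_suminf_le[OF le]) (use sum in \<open>simp only: summable_Suc_iff[of "\<lambda>n. real (Suc n) powr (-\<sigma>)"]\<close>)
  also have "\<dots> = Re (riemann_zeta (of_real \<sigma>)) - 1"
    unfolding Re_riemann_zeta[OF s(1)] using suminf_split_head[OF sum] by simp
  finally show "norm (dirichlet_series chi s - chi 1) \<le> Re (riemann_zeta (of_real \<sigma>)) - 1" .
qed

text \<open>Termwise, the derivative of \<open>n\<close> powr \<open>-s\<close> costs a factor \<open>ln n\<close>. This is at most \<open>n\<close> powr
  \<open>\<epsilon>\<close> divided by \<open>\<epsilon>\<close>, and \<open>\<epsilon> = (\<sigma> - 1) / 2\<close> leaves the exponent \<open>(\<sigma> + 1) / 2 > 1\<close>.\<close>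

lemma dirichlet_series_lipschitz:
  assumes chi: "\<And>n. norm (chi (Suc n)) \<le> 1" and \<sigma>: "1 < \<sigma>" "\<sigma> \<le> Re z" "\<sigma> \<le> Re w"
  shows "norm (dirichlet_series chi z - dirichlet_series chi w)
    \<le> 2 / (\<sigma> - 1) * Re (riemann_zeta (of_real ((\<sigma> + 1) / 2))) * norm (z - w)"
proof -
  let ?f = "\<lambda>s n. chi (Suc n) * of_nat (Suc n) powr (-s)"
  define \<epsilon> where "\<epsilon> = (\<sigma> - 1) / 2"
  define \<tau> where "\<tau> = (\<sigma> + 1) / 2"
  have \<epsilon>: "\<epsilon> > 0" and \<tau>: "\<tau> > 1" and sum: "\<epsilon> - \<sigma> = - \<tau>" using \<sigma> by (auto simp: \<epsilon>_def \<tau>_def field_simps)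
  have term_le: "norm (?f z n - ?f w n) \<le> real (Suc n) powr (-\<tau>) / \<epsilon> * norm (z - w)" for n
  proof (rule field_differentiable_bound[of "{s. \<sigma> \<le> Re s}" "\<lambda>s. ?f s n" "\<lambda>s. - of_real (ln (real (Suc n))) * ?f s n"])
    show "convex {s. \<sigma> \<le> Re s}" by (rule convex_halfspace_Re_ge)
    fix s assume s: "s \<in> {s. \<sigma> \<le> Re s}"
    have "Ln (of_nat (Suc n)) = complex_of_real (ln (real (Suc n)))"
      using Ln_of_real[of "real (Suc n)"] by simp
    then show "((\<lambda>s. ?f s n) has_field_derivative - of_real (ln (real (Suc n))) * ?f s n) (at s within {s. \<sigma> \<le> Re s})"
      by (auto intro!: derivative_eq_intros simp: powr_def)
    have ln: "0 \<le> ln (real (Suc n))" "ln (real (Suc n)) \<le> real (Suc n) powr \<epsilon> / \<epsilon>"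
      using \<epsilon> by (simp, intro ln_powr_bound) auto
    have "norm (- of_real (ln (real (Suc n))) * ?f s n) = ln (real (Suc n)) * norm (?f s n)"
      using ln(1) by (simp add: norm_mult)
    also have "\<dots> \<le> real (Suc n) powr \<epsilon> / \<epsilon> * real (Suc n) powr (-\<sigma>)"
      using s \<epsilon> ln by (intro mult_mono order_trans[OF norm_dirichlet_term_le[of chi, OF chi]] powr_mono) auto
    also have "\<dots> = real (Suc n) powr (-\<tau>) / \<epsilon>"
      by (simp flip: powr_add sum)
    finally show "norm (- of_real (ln (real (Suc n))) * ?f s n) \<le> real (Suc n) powr (-\<tau>) / \<epsilon>" .
  qed (use \<sigma> in auto)
  have "dirichlet_series chi z - dirichlet_series chi w = (\<Sum>n. ?f z n - ?f w n)"
    unfolding dirichlet_series_def using \<sigma>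
    by (intro suminf_diff summable_dirichlet_series chi) auto
  also have "norm \<dots> \<le> (\<Sum>n. real (Suc n) powr (-\<tau>) / \<epsilon> * norm (z - w))"
    by (intro norm_suminf_le term_le summable_mult2 summable_divide summable_Suc_powr \<tau>)
  also have "\<dots> = Re (riemann_zeta (of_real \<tau>)) / \<epsilon> * norm (z - w)"
    unfolding Re_riemann_zeta[OF \<tau>]
    using suminf_mult2[OF summable_divide[OF summable_Suc_powr[OF \<tau>]], of \<epsilon> "norm (z - w)"]
      suminf_divide[OF summable_Suc_powr[OF \<tau>], of \<epsilon>] by simp
  finally show ?thesis unfolding \<epsilon>_def \<tau>_def by (simp add: mult_ac)
qed

lemma continuous_on_dirichlet_series:
  assumes chi: "\<And>n. norm (chi (Suc n)) \<le> 1" and "1 < \<sigma>"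
  shows "continuous_on {s. \<sigma> \<le> Re s} (dirichlet_series chi)"
proof -
  let ?K = "2 / (\<sigma> - 1) * Re (riemann_zeta (of_real ((\<sigma> + 1) / 2)))"
  have "0 \<le> ?K"
    using assms(2) norm_ge_zero[THEN order_trans, OF norm_dirichlet_series_le[of chi "(\<sigma> + 1) / 2" "of_real \<sigma>", OF chi]]
    by auto
  then have "?K-lipschitz_on {s. \<sigma> \<le> Re s} (dirichlet_series chi)"
    using dirichlet_series_lipschitz[of chi \<sigma>, OF chi assms(2)]
    by (intro lipschitz_onI) (auto simp: dist_norm)
  then show ?thesis by (rule lipschitz_on_continuous_on)
qed

text \<open>A function is continuous only away from its poles. This serves twice: every zero of the real part to
  the right of \<open>1\<close> counts in \<^const>\<open>sigma0\<close>, and solutions in this half-plane avoid the poles.\<close>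

lemma not_pole_dirichlet_L:
  assumes chi: "\<And>n. norm (chi (Suc n)) \<le> 1" and z: "Re z > 1"
  shows "\<not> is_pole (dirichlet_L chi) z"
proof
  assume pole: "is_pole (dirichlet_L chi) z"
  define \<sigma> where "\<sigma> = (1 + Re z) / 2"
  have \<sigma>: "1 < \<sigma>" "\<sigma> < Re z" using z by (auto simp: \<sigma>_def)
  have op: "open {s. \<sigma> < Re s}" by (rule open_halfspace_Re_gt)
  have "continuous_on {s. \<sigma> < Re s} (dirichlet_L chi)"
    using continuous_on_subset[OF continuous_on_dirichlet_series[of chi \<sigma>, OF chi \<sigma>(1)], of "{s. \<sigma> < Re s}"] \<sigma>(1)
    by (subst continuous_on_cong[OF refl, where g = "dirichlet_series chi"])
      (auto simp: dirichlet_L_def subset_iff)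
  then have "isCont (dirichlet_L chi) z"
    using \<sigma> op by (simp add: continuous_on_eq_continuous_at)
  then show False
    using pole not_tendsto_and_filterlim_at_infinity[of "at z" "dirichlet_L chi"]
    by (auto simp: is_pole_def isCont_def)
qed

lemma principal_character_values:
  assumes chi: "principal_character m chi"
  shows "chi (Suc n) = 1 \<or> chi (Suc n) = 0"
proof -
  have "m \<ge> 1" using chi by (simp add: principal_character_def dirichlet_character_def)
  then have "gcd (Suc n) m = 1 \<or> gcd (Suc n) m > 1"
    using gcd_pos_nat[of "Suc n" m] by linarith
  then show ?thesis
    using chi unfolding principal_character_def dirichlet_character_def by (metis le_add1 plus_1_eq_Suc)
qed

lemma norm_principal_character_le: "principal_character m chi \<Longrightarrow> norm (chi (Suc n)) \<le> 1"
  using principal_character_values[of m chi n] by auto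

text \<open>All terms are nonnegative and the first one is \<open>1\<close>.\<close>

lemma Re_dirichlet_series_real_pos:
  assumes chi: "principal_character m chi" and \<sigma>: "\<sigma> > 1"
  shows "Re (dirichlet_series chi (of_real \<sigma>)) > 0"
proof -
  let ?f = "\<lambda>n. chi (Suc n) * of_nat (Suc n) powr (- complex_of_real \<sigma>)"
  have sum: "summable ?f"
    using norm_principal_character_le[OF chi] \<sigma> by (intro summable_dirichlet_series) auto
  have one: "chi 1 = 1" using chi by (simp add: principal_character_def)
  have "0 \<le> Re (?f n)" for n
  proof -
    have "chi (Suc n) = 1 \<or> chi (Suc n) = 0" by (rule principal_character_values[OF chi])
    moreover have "of_nat (Suc n) powr (- complex_of_real \<sigma>) = of_real (real (Suc n) powr (-\<sigma>))"
      using powr_of_real[of "real (Suc n)" "-\<sigma>"] by simp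
    ultimately show ?thesis by (auto simp del: of_nat_Suc)
  qed
  then have "(\<Sum>n<1. Re (?f n)) \<le> (\<Sum>n. Re (?f n))"
    by (intro sum_le_suminf summable_Re sum) auto
  also have "(\<Sum>n. Re (?f n)) = Re (dirichlet_series chi (of_real \<sigma>))"
    unfolding dirichlet_series_def by (rule Re_suminf[OF sum, symmetric])
  finally show ?thesis using one by simp
qed

text \<open>On the vertical line through \<open>s\<close> the real part of the series is positive at the real point. If it
  were not positive at \<open>s\<close>, then it would vanish somewhere in between, which the definition of
  \<^const>\<open>sigma0\<close> excludes.\<close>

lemma Re_dirichlet_series_pos:
  assumes chi: "principal_character m chi" and s: "Re s > 1" "ereal (Re s) > sigma0 (dirichlet_L chi)"
  shows "Re (dirichlet_series chi s) > 0"
proof (rule ccontr)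
  note le1 = norm_principal_character_le[OF chi]
  define \<sigma> where "\<sigma> = Re s"
  define f where "f y = Re (dirichlet_series chi (Complex \<sigma> y))" for y
  assume "\<not> Re (dirichlet_series chi s) > 0"
  then have neg: "f (Im s) \<le> 0" by (simp add: f_def \<sigma>_def complex_eq_iff not_less)
  have pos: "f 0 \<ge> 0"
    using Re_dirichlet_series_real_pos[OF chi s(1)] by (simp add: f_def \<sigma>_def complex_of_real_def)
  have "continuous_on UNIV (\<lambda>y. dirichlet_series chi (Complex \<sigma> y))"
    by (rule continuous_on_compose2[OF continuous_on_dirichlet_series[of chi \<sigma>, OF le1]])
      (use s(1) in \<open>auto simp: \<sigma>_def Complex_eq intro!: continuous_intros\<close>)
  then have cont: "continuous_on A f" for A
    unfolding f_def by (intro continuous_on_Re) (auto intro: continuous_on_subset)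
  have "\<exists>y. f y = 0"
    using IVT'[of f "Im s" 0 0] IVT2'[of f "Im s" 0 0] neg pos cont
    by (cases "Im s \<le> 0") (auto simp: not_le less_imp_le)
  then obtain y where y: "f y = 0" by blast
  have "\<sigma> \<in> {\<sigma>. \<exists>t. \<not> is_pole (dirichlet_L chi) (Complex \<sigma> t) \<and> Re (dirichlet_L chi (Complex \<sigma> t)) = 0}"
    using y s(1) not_pole_dirichlet_L[of chi "Complex \<sigma> y", OF le1]
    by (auto simp: f_def dirichlet_L_def \<sigma>_def intro!: exI[of _ y])
  then have "ereal \<sigma> \<le> sigma0 (dirichlet_L chi)"
    unfolding sigma0_def by (intro Sup_upper imageI)
  then show False using s(2) by (simp add: \<sigma>_def)
qed

section \<open>The invariant half-plane and global solutions\<close>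

lemma
  fixes f :: "real \<Rightarrow> complex"
  assumes t: "t \<ge> 0" and f: "set_integrable lborel {0..t} f"
  shows Re_set_integral_ge: "(\<And>s. s \<in> {0..t} \<Longrightarrow> a \<le> Re (f s)) \<Longrightarrow> a * t \<le> Re (LINT s:{0..t}|lborel. f s)"
    and Re_set_integral_le: "(\<And>s. s \<in> {0..t} \<Longrightarrow> Re (f s) \<le> a) \<Longrightarrow> Re (LINT s:{0..t}|lborel. f s) \<le> a * t"
    and Im_set_integral_ge: "(\<And>s. s \<in> {0..t} \<Longrightarrow> a \<le> Im (f s)) \<Longrightarrow> a * t \<le> Im (LINT s:{0..t}|lborel. f s)"
    and Im_set_integral_le: "(\<And>s. s \<in> {0..t} \<Longrightarrow> Im (f s) \<le> a) \<Longrightarrow> Im (LINT s:{0..t}|lborel. f s) \<le> a * t"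
proof -
  have re: "set_integrable lborel {0..t} (\<lambda>s. Re (f s))"
    "Re (LINT s:{0..t}|lborel. f s) = (LINT s:{0..t}|lborel. Re (f s))"
    using integrable_Re[OF f[unfolded set_integrable_def]] integral_Re[OF f[unfolded set_integrable_def]]
    by (simp_all add: set_integrable_def set_lebesgue_integral_def)
  have im: "set_integrable lborel {0..t} (\<lambda>s. Im (f s))"
    "Im (LINT s:{0..t}|lborel. f s) = (LINT s:{0..t}|lborel. Im (f s))"
    using integrable_Im[OF f[unfolded set_integrable_def]] integral_Im[OF f[unfolded set_integrable_def]]
    by (simp_all add: set_integrable_def set_lebesgue_integral_def)
  have c: "set_integrable lborel {0..t} (\<lambda>s. a)" "(LINT s:{0..t}|lborel. a) = a * t"
    using t by (simp_all add: set_integrable_def set_integral_const)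
  show "a * t \<le> Re (LINT s:{0..t}|lborel. f s)" if "\<And>s. s \<in> {0..t} \<Longrightarrow> a \<le> Re (f s)"
    using set_integral_mono[OF c(1) re(1) that] c(2) re(2) by simp
  show "Re (LINT s:{0..t}|lborel. f s) \<le> a * t" if "\<And>s. s \<in> {0..t} \<Longrightarrow> Re (f s) \<le> a"
    using set_integral_mono[OF re(1) c(1) that] c(2) re(2) by simp
  show "a * t \<le> Im (LINT s:{0..t}|lborel. f s)" if "\<And>s. s \<in> {0..t} \<Longrightarrow> a \<le> Im (f s)"
    using set_integral_mono[OF c(1) im(1) that] c(2) im(2) by simp
  show "Im (LINT s:{0..t}|lborel. f s) \<le> a * t" if "\<And>s. s \<in> {0..t} \<Longrightarrow> Im (f s) \<le> a"
    using set_integral_mono[OF im(1) c(1) that] c(2) im(2) by simp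
qed

text \<open>A continuity argument with a gap. As long as the solution stays in the half-plane \<open>Re z \<ge> b\<close>, the
  Duhamel term has nonnegative real part, so the solution even satisfies the stronger bound \<open>a\<close>. A first
  time \<open>c\<close> of violating the bound \<open>b\<close> would require a jump over the gap \<open>a - b\<close>. At \<open>c = 0\<close> the jump
  is excluded by the uniform convergence to the heat evolution, at \<open>c > 0\<close> by norm continuity.\<close>

lemma Re_mild_solution_ge:
  fixes g :: "'a::euclidean_space \<Rightarrow>\<^sub>C complex"
  assumes v: "mild_solution F g T v" and g: "\<And>x. a \<le> Re (apply_bcontfun g x)"
    and ba: "b < a" and F: "\<And>z. b \<le> Re z \<Longrightarrow> 0 \<le> Re (F z)"
    and t: "0 \<le> t" "ereal t < T"
  shows "a \<le> Re (apply_bcontfun (v t) x)"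
proof -
  have heat: "a \<le> Re (heat_semigroup t (apply_bcontfun g) x)" if "t \<ge> 0" for t x
    by (rule Re_heat_semigroup_bounds(1)[OF that apply_bcontfun g])
  have T: "ereal s < T" if "s \<le> t" "ereal t < T" for s t
    using that by (meson ereal_less_eq(3) le_less_trans)
  have above: "a \<le> Re (apply_bcontfun (v t) x)"
    if t: "0 \<le> t" "ereal t < T" and below: "\<And>s y. s \<in> {0..t} \<Longrightarrow> b \<le> Re (apply_bcontfun (v s) y)" for t x
  proof -
    let ?h = "\<lambda>s. heat_semigroup (t - s) (\<lambda>y. F (apply_bcontfun (v s) y)) x"
    have int: "set_integrable lborel {0..t} ?h"
      and eq: "apply_bcontfun (v t) x = heat_semigroup t (apply_bcontfun g) x + (LINT s:{0..t}|lborel. ?h s)"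
      using v t unfolding mild_solution_def by blast+
    have "0 \<le> Re (?h s)" if s: "s \<in> {0..t}" for s
    proof (rule Re_heat_semigroup_bounds(1))
      show "(\<lambda>y. F (apply_bcontfun (v s) y)) \<in> bcontfun"
        using v s T[OF _ t(2), of s] unfolding mild_solution_def by auto
    qed (use s F below[OF s] in auto)
    then have "0 * t \<le> Re (LINT s:{0..t}|lborel. ?h s)"
      by (intro Re_set_integral_ge[OF t(1) int])
    with heat[OF t(1), of x] show ?thesis by (simp add: eq)
  qed
  define B where "B = {s. 0 \<le> s \<and> s \<le> t \<and> (\<exists>y. Re (apply_bcontfun (v s) y) < b)}"
  have "B = {}"
  proof (rule ccontr)
    assume ne: "B \<noteq> {}"
    define c where "c = Inf B"
    have bdd: "bdd_below B" by (rule bdd_belowI[of _ 0]) (simp add: B_def)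
    have c: "0 \<le> c" "c \<le> t"
      unfolding c_def using ne bdd
      by (auto simp: B_def intro: cInf_greatest cInf_lower2)
    have cT: "ereal c < T" by (rule T[OF c(2) t(2)])
    have before: "b \<le> Re (apply_bcontfun (v s) y)" if "0 \<le> s" "s < c" for s y
      using that c(2) cInf_lower[OF _ bdd, of s] unfolding c_def[symmetric]
      by (force simp: B_def not_less[symmetric])
    then have before_a: "a \<le> Re (apply_bcontfun (v s) y)" if "0 \<le> s" "s < c" for s y
      using that T[OF _ cT, of s] by (intro above) auto
    have "\<exists>e>0. \<forall>s y. 0 \<le> s \<and> s < c + e \<and> s \<le> t \<longrightarrow> b \<le> Re (apply_bcontfun (v s) y)"
    proof (cases "c = 0")
      case True
      have "\<forall>\<^sub>F s in at_right 0. \<forall>y\<in>UNIV.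
          dist (apply_bcontfun (v s) y - heat_semigroup s (apply_bcontfun g) y) 0 < a - b"
        using v ba by (intro uniform_limitD) (auto simp: mild_solution_def)
      then obtain e where e: "e > 0"
        "\<And>s y. 0 < s \<Longrightarrow> s < e \<Longrightarrow> norm (apply_bcontfun (v s) y - heat_semigroup s (apply_bcontfun g) y) < a - b"
        unfolding eventually_at_right_field by auto
      have "b \<le> Re (apply_bcontfun (v s) y)" if "0 \<le> s" "s < e" for s y
      proof (cases "s = 0")
        case True
        have "apply_bcontfun (v 0) y = heat_semigroup 0 (apply_bcontfun g) y
            + (LINT s:{0..0}|lborel. heat_semigroup (0 - s) (\<lambda>y. F (apply_bcontfun (v s) y)) y)"
          using v by (auto simp: mild_solution_def zero_ereal_def)
        also have "(LINT s:{0..0}|lborel. heat_semigroup (0 - s) (\<lambda>y. F (apply_bcontfun (v s) y)) y) = 0"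
          by (subst set_integral_discrete_difference[where X = "{0}" and B = "{}"]) (auto simp: set_lebesgue_integral_def)
        finally show ?thesis using True heat[of 0 y] ba by simp
      next
        case False
        with that e(2)[of s y] abs_Re_le_cmod[of "apply_bcontfun (v s) y - heat_semigroup s (apply_bcontfun g) y"]
          heat[of s y]
        show ?thesis by auto
      qed
      with e(1) True show ?thesis by auto
    next
      case False
      with c have c0: "c > 0" by simp
      have "continuous_on {s. 0 < s \<and> ereal s < T} v" using v by (simp add: mild_solution_def)
      moreover have "open {s. 0 < s \<and> ereal s < T}"
        by (intro open_Collect_conj open_Collect_less continuous_intros)
      ultimately have "isCont v c" using c0 cT by (simp add: continuous_on_eq_continuous_at)
      then obtain e where e: "e > 0" "\<And>s. dist s c < e \<Longrightarrow> dist (v s) (v c) < (a - b) / 2"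
        using ba unfolding continuous_at_eps_delta by (metis diff_gt_0_iff_gt half_gt_zero)
      have near: "\<bar>Re (apply_bcontfun (v s) y) - Re (apply_bcontfun (v c) y)\<bar> < (a - b) / 2"
        if "dist s c < e" for s y
        using dist_fun_lt_imp_dist_val_lt[OF e(2)[OF that], of y]
          abs_Re_le_cmod[of "apply_bcontfun (v s) y - apply_bcontfun (v c) y"] by (simp add: dist_norm)
      \<comment> \<open>The bound \<open>a\<close> is known only before time \<open>c\<close>; passing to \<open>c\<close> costs half of the gap, and the
        time after \<open>c\<close> the other half.\<close>
      have half: "a - (a - b) / 2 \<le> Re (apply_bcontfun (v c) y)" for y
      proof -
        define s where "s = max (c / 2) (c - e / 2)"
        have "0 \<le> s" "s < c" "dist s c < e"
          using c0 e(1) by (auto simp: s_def dist_real_def max_def)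
        with near[of s y] before_a[of s y] show ?thesis by linarith
      qed
      have "b \<le> Re (apply_bcontfun (v s) y)" if "0 \<le> s" "s < c + e" for s y
      proof (cases "s < c")
        case True then show ?thesis using before that by simp
      next
        case False
        with that have "dist s c < e" by (simp add: dist_real_def)
        from near[OF this, of y] have "Re (apply_bcontfun (v c) y) - Re (apply_bcontfun (v s) y) < (a - b) / 2"
          by linarith
        with half[of y] show ?thesis by (simp add: field_simps)
      qed
      with e(1) show ?thesis by auto
    qed
    then obtain e where e: "e > 0" "\<And>s y. 0 \<le> s \<Longrightarrow> s < c + e \<Longrightarrow> s \<le> t \<Longrightarrow> b \<le> Re (apply_bcontfun (v s) y)"
      by blast
    have "c + e \<le> c"
      unfolding c_def[of] using e(2) ne by (intro cInf_greatest) (fastforce simp: B_def c_def not_less[symmetric])+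
    with e(1) show False by simp
  qed
  then have "b \<le> Re (apply_bcontfun (v s) y)" if "s \<in> {0..t}" for s y
    using that by (force simp: B_def not_less[symmetric])
  with above[OF t] show ?thesis by blast
qed

theorem theorem1p4:
  fixes m :: nat and chi :: "nat \<Rightarrow> complex"
    and g :: "(real ^ 'd) \<Rightarrow>\<^sub>C complex"
    and I1 I2 S1 S2 :: real
  assumes "principal_character m chi"
    and "I1 = (INF x. Re (apply_bcontfun g x))" and "S1 = (SUP x. Re (apply_bcontfun g x))"
    and "I2 = (INF x. Im (apply_bcontfun g x))" and "S2 = (SUP x. Im (apply_bcontfun g x))"
    and "ereal I1 > max 1 (sigma0 (dirichlet_L chi))"
  shows "(\<exists>T u. local_solution (dirichlet_L chi) g T u) \<and>
    (\<forall>T u. local_solution (dirichlet_L chi) g T u \<longrightarrow>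
       T = \<infinity> \<and>
       (\<forall>t\<ge>0. \<forall>x.
          max 0 (2 - Re (riemann_zeta (of_real I1))) * t + I1 \<le> Re (apply_bcontfun (u t) x) \<and>
          Re (apply_bcontfun (u t) x) \<le> Re (riemann_zeta (of_real I1)) * t + S1 \<and>
          (1 - Re (riemann_zeta (of_real I1))) * t + I2 \<le> Im (apply_bcontfun (u t) x) \<and>
          Im (apply_bcontfun (u t) x) \<le> (Re (riemann_zeta (of_real I1)) - 1) * t + S2))"
proof -
  define L where "L = dirichlet_L chi"
  define Z where "Z = Re (riemann_zeta (of_real I1))"
  define K where "K = 2 / (I1 - 1) * Re (riemann_zeta (of_real ((I1 + 1) / 2)))"
  \<comment> \<open>The nearest-point projection onto the half-plane; it does not increase distances.\<close>
  define p where "p z = Complex (max I1 (Re z)) (Im z)" for z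
  define G where "G z = dirichlet_series chi (p z)" for z
  note chi = assms(1)
  note le1 = norm_principal_character_le[OF chi]
  have one: "chi 1 = 1" using chi by (simp add: principal_character_def)
  have I1: "I1 > 1" using assms(6) by (simp add: one_ereal_def)
  \<comment> \<open>Room below \<open>I1\<close> in which \<open>Re L \<ge> 0\<close> still holds, as the continuity argument requires.\<close>
  obtain b where b: "max 1 (sigma0 L) < ereal b" "ereal b < ereal I1"
    using ereal_dense2[OF assms(6)] unfolding L_def by blast
  have L_eq: "L z = dirichlet_series chi z" if "Re z > 1" for z
    using that by (simp add: L_def dirichlet_L_def)
  have L_pos: "0 \<le> Re (L z)" if "b \<le> Re z" for z
  proof -
    have "max 1 (sigma0 L) < ereal (Re z)"
      using b(1) that by (meson ereal_less_eq(3) less_le_trans)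
    then have "Re z > 1" "ereal (Re z) > sigma0 L" by (simp_all add: one_ereal_def)
    then show ?thesis
      using Re_dirichlet_series_pos[OF chi] L_eq by (simp add: L_def less_imp_le)
  qed
  have Re_p: "I1 \<le> Re (p z)" for z by (simp add: p_def)
  have p_id: "p z = z" if "I1 \<le> Re z" for z using that by (simp add: p_def complex_eq_iff)
  have p_lip: "norm (p z - p w) \<le> norm (z - w)" for z w
  proof -
    have "\<bar>max I1 (Re z) - max I1 (Re w)\<bar> \<le> \<bar>Re z - Re w\<bar>" by (auto simp: max_def)
    then show ?thesis
      by (auto simp: p_def norm_complex_def abs_le_square_iff)
  qed
  have G_eq: "G z = L z" if "I1 \<le> Re z" for z
    using that I1 by (simp add: G_def p_id L_eq)
  interpret bounded_lipschitz G K Z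
  proof
    fix z w
    have K0: "0 \<le> K"
      using I1 norm_ge_zero[THEN order_trans, OF norm_dirichlet_series_le[of chi "(I1 + 1) / 2" "of_real I1", OF le1]]
      by (auto simp: K_def)
    have "norm (G z - G w) \<le> K * norm (p z - p w)"
      unfolding G_def K_def by (intro dirichlet_series_lipschitz le1 I1 Re_p)
    also have "\<dots> \<le> K * norm (z - w)" by (intro mult_left_mono p_lip K0)
    finally show "norm (G z - G w) \<le> K * norm (z - w)" .
    show "norm (G z) \<le> Z"
      unfolding G_def Z_def by (intro norm_dirichlet_series_le le1 I1 Re_p)
  qed
  have G_bounds: "max 0 (2 - Z) \<le> Re (G z)" "Re (G z) \<le> Z" "1 - Z \<le> Im (G z)" "Im (G z) \<le> Z - 1" for z
  proof -
    have "norm (G z - 1) \<le> Z - 1"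
      using norm_dirichlet_series_diff_le[of chi, OF le1 I1 Re_p[of z]] by (simp only: G_def Z_def one)
    then have "\<bar>Re (G z) - 1\<bar> \<le> Z - 1" "\<bar>Im (G z)\<bar> \<le> Z - 1"
      using abs_Re_le_cmod[of "G z - 1"] abs_Im_le_cmod[of "G z - 1"] by auto
    moreover have "0 \<le> Re (G z)"
      using L_pos[of "p z"] Re_p[of z] b(2) L_eq[of "p z"] I1 by (simp add: G_def)
    ultimately show "max 0 (2 - Z) \<le> Re (G z)" "Re (G z) \<le> Z" "1 - Z \<le> Im (G z)" "Im (G z) \<le> Z - 1"
      by auto
  qed
  have g_bounds: "I1 \<le> Re (apply_bcontfun g x)" "Re (apply_bcontfun g x) \<le> S1"
    "I2 \<le> Im (apply_bcontfun g x)" "Im (apply_bcontfun g x) \<le> S2" for x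
  proof -
    have re: "\<bar>Re (apply_bcontfun g x)\<bar> \<le> norm g" and im: "\<bar>Im (apply_bcontfun g x)\<bar> \<le> norm g" for x
      using abs_Re_le_cmod abs_Im_le_cmod norm_bounded order_trans by blast+
    have bdd: "bdd_below (range (\<lambda>x. Re (apply_bcontfun g x)))" "bdd_above (range (\<lambda>x. Re (apply_bcontfun g x)))"
      "bdd_below (range (\<lambda>x. Im (apply_bcontfun g x)))" "bdd_above (range (\<lambda>x. Im (apply_bcontfun g x)))"
      using re im by (auto intro!: bdd_belowI2[of _ "- norm g"] bdd_aboveI2[of _ _ "norm g"] simp: abs_le_iff minus_le_iff)
    show "I1 \<le> Re (apply_bcontfun g x)" "Re (apply_bcontfun g x) \<le> S1"
      "I2 \<le> Im (apply_bcontfun g x)" "Im (apply_bcontfun g x) \<le> S2"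
      unfolding assms(2-5) by (intro cINF_lower cSUP_upper bdd UNIV_I)+
  qed
  obtain U where U_cont: "continuous_on {0<..} U"
    and U: "\<And>t. t \<ge> 0 \<Longrightarrow> U t = heat_flow g t + duhamel_flow (\<lambda>s. nemytskii G (U s)) t"
    by (rule exists_mild_flow[of g]) blast
  note h = continuous_on_nemytskii[OF U_cont] norm_nemytskii_le
  have U_int: "set_integrable lborel {0..t} (\<lambda>s. heat_semigroup (t - s) (\<lambda>y. G (apply_bcontfun (U s) y)) x)" for t x
    using set_integrable_duhamel[OF h, of t x] by simp
  have U_duhamel: "apply_bcontfun (U t) x = heat_semigroup t (apply_bcontfun g) x
      + duhamel (\<lambda>s. nemytskii G (U s)) t x" if "t \<ge> 0" for t x
    using that by (simp add: U[OF that] apply_heat_flow apply_duhamel_flow[OF h that])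
  then have U_eq: "apply_bcontfun (U t) x = heat_semigroup t (apply_bcontfun g) x
      + (LINT s:{0..t}|lborel. heat_semigroup (t - s) (\<lambda>y. G (apply_bcontfun (U s) y)) x)" if "t \<ge> 0" for t x
    using that by (simp add: duhamel_def)
  have U_bounds: "max 0 (2 - Z) * t + I1 \<le> Re (apply_bcontfun (U t) x)"
      "Re (apply_bcontfun (U t) x) \<le> Z * t + S1"
      "(1 - Z) * t + I2 \<le> Im (apply_bcontfun (U t) x)"
      "Im (apply_bcontfun (U t) x) \<le> (Z - 1) * t + S2" if t: "t \<ge> 0" for t x
    unfolding U_eq[OF t] plus_complex.sel
    by (subst add.commute, intro add_mono Re_heat_semigroup_bounds[OF t apply_bcontfun] g_bounds
        Re_set_integral_ge Re_set_integral_le Im_set_integral_ge Im_set_integral_le t U_int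
        Re_heat_semigroup_bounds[OF _ comp_bcontfun] G_bounds; simp)+
  have U_ge: "I1 \<le> Re (apply_bcontfun (U t) x)" if "t \<ge> 0" for t x
    using U_bounds(1)[OF that, of x] mult_nonneg_nonneg[OF max.cobounded1[of 0 "2 - Z"] that] by linarith
  have GL: "(\<lambda>y. L (apply_bcontfun w y)) = (\<lambda>y. G (apply_bcontfun w y))"
    if "\<And>y. I1 \<le> Re (apply_bcontfun w y)" for w :: "(real ^ 'd) \<Rightarrow>\<^sub>C complex"
    using that by (simp add: G_eq)
  have U_mild: "mild_solution L g \<infinity> U"
    unfolding mild_solution_def
  proof (intro conjI allI impI; (elim conjE)?)
    show "(0::ereal) < \<infinity>" by simp
    show "continuous_on {t. 0 < t \<and> ereal t < \<infinity>} U"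
      using U_cont by (simp add: greaterThan_def)
    show "uniform_limit UNIV (\<lambda>t x. apply_bcontfun (U t) x - heat_semigroup t (apply_bcontfun g) x) (\<lambda>_. 0) (at_right 0)"
    proof (rule uniform_limitI)
      fix e :: real assume "e > 0"
      have "((\<lambda>t. Z * t) \<longlongrightarrow> Z * 0) (at_right 0)" by (intro tendsto_intros)
      then have "\<forall>\<^sub>F t in at_right 0. Z * t < e" using \<open>e > 0\<close> by (intro order_tendstoD) auto
      with eventually_at_right_less[of 0]
      show "\<forall>\<^sub>F t in at_right 0. \<forall>x\<in>UNIV.
          dist (apply_bcontfun (U t) x - heat_semigroup t (apply_bcontfun g) x) 0 < e"
      proof eventually_elim
        case (elim t)
        then show ?case
          using norm_duhamel_le[OF h, of t] by (auto simp: U_duhamel intro: le_less_trans)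
      qed
    qed
    fix t :: real assume t: "0 \<le> t"
    show "\<not> is_pole L (apply_bcontfun (U t) x)" for x
      using not_pole_dirichlet_L[of chi, OF le1] U_ge[OF t, of x] I1 by (simp add: L_def)
    show "(\<lambda>x. L (apply_bcontfun (U t) x)) \<in> bcontfun"
      unfolding GL[OF U_ge[OF t]] by (rule comp_bcontfun)
    fix x
    have cong: "heat_semigroup (t - s) (\<lambda>y. L (apply_bcontfun (U s) y)) x
        = heat_semigroup (t - s) (\<lambda>y. G (apply_bcontfun (U s) y)) x" if "s \<in> {0..t}" for s
      using that by (simp add: GL[OF U_ge])
    show "set_integrable lborel {0..t} (\<lambda>s. heat_semigroup (t - s) (\<lambda>y. L (apply_bcontfun (U s) y)) x)"
      using U_int by (subst set_integrable_cong[OF refl refl cong])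
    show "apply_bcontfun (U t) x = heat_semigroup t (apply_bcontfun g) x
      + (LINT s:{0..t}|lborel. heat_semigroup (t - s) (\<lambda>y. L (apply_bcontfun (U s) y)) x)"
      unfolding U_eq[OF t] using cong by (subst set_lebesgue_integral_cong) auto
  qed
  have unique: "v t = U t" if v: "mild_solution L g T v" and t: "0 \<le> t" "ereal t < T" for T v t
  proof (rule mild_flow_unique[where A = "{t. 0 \<le> t \<and> ereal t < T}"])
    have v_ge: "I1 \<le> Re (apply_bcontfun (v s) y)" if "0 \<le> s" "ereal s < T" for s y
      by (rule Re_mild_solution_ge[OF v g_bounds(1) _ L_pos that]) (use b in auto)
    fix t x assume "t \<in> {t. 0 \<le> t \<and> ereal t < T}"
    then have t: "0 \<le> t" "ereal t < T" by auto
    have cong: "heat_semigroup (t - s) (\<lambda>y. G (apply_bcontfun (v s) y)) x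
        = heat_semigroup (t - s) (\<lambda>y. L (apply_bcontfun (v s) y)) x" if "s \<in> {0..t}" for s
    proof -
      have "ereal s < T" using that t(2) by (meson atLeastAtMost_iff ereal_less_eq(3) le_less_trans)
      then show ?thesis using that by (simp add: GL[OF v_ge])
    qed
    show "set_integrable lborel {0..t} (\<lambda>s. heat_semigroup (t - s) (\<lambda>y. G (apply_bcontfun (v s) y)) x)"
      using v t by (subst set_integrable_cong[OF refl refl cong]) (auto simp: mild_solution_def)
    have "apply_bcontfun (v t) x = heat_semigroup t (apply_bcontfun g) x
      + (LINT s:{0..t}|lborel. heat_semigroup (t - s) (\<lambda>y. L (apply_bcontfun (v s) y)) x)"
      using v t by (auto simp: mild_solution_def)
    then show "apply_bcontfun (v t) x = heat_semigroup t (apply_bcontfun g) x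
      + (LINT s:{0..t}|lborel. heat_semigroup (t - s) (\<lambda>y. G (apply_bcontfun (v s) y)) x)"
      using cong by (subst set_lebesgue_integral_cong) auto
    show "{0..t} \<subseteq> {t. 0 \<le> t \<and> ereal t < T}"
      using t by (auto intro: le_less_trans[of "ereal _" "ereal t"])
  qed (use U_int U_eq t in auto)
  have "local_solution L g \<infinity> U"
    using U_mild unique by (simp add: local_solution_def)
  moreover have "T = \<infinity> \<and> (\<forall>t\<ge>0. u t = U t)" if "local_solution L g T u" for T u
  proof -
    have "\<infinity> \<le> T" and "\<forall>t. 0 \<le> t \<and> ereal t < \<infinity> \<longrightarrow> U t = u t"
      using that U_mild unfolding local_solution_def by blast+
    then show ?thesis by simp
  qed
  ultimately show ?thesis
    using U_bounds unfolding L_def[symmetric] Z_def[symmetric] by metis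
qed

end
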